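(* Suppose $\rho$ is a constant function, $\rho\equiv\rho(0)>0$, let $\nu>0$, and let $\Gamma^{(\nu)}$ be the Stratonovich solution of $$d\theta(t,x,y)=\nu\,(\partial_x^2+\partial_y^2)\theta(t,x,y)\,dt+\sqrt{\rho(0)}\,\partial_y\theta(t,x,y)\circ dW_t\quad\text{on }(0,\infty)\times\mathbb{R}^2,\qquad\theta(0)=\delta_0\otimes\delta_0,$$ where $W=\{W_t\}_{t\ge0}$ is a standard Brownian motion. Then, with probability one, $$\mathrm{Dim}_{\rm M}\left\{t>0:\ \Gamma^{(\nu)}_t(0,0)>\frac Kt\right\}=\begin{cases}1&\text{if }0<K<(4\pi\nu)^{-1},\\0&\text{if }K\ge(4\pi\nu)^{-1}.\end{cases}$$ Furthermore, for any $x\in\mathbb{R}$, $$\mathrm{Dim}_{\rm M}\left\{t>0:\ \Gamma^{(\nu)}_t(0,0)=\frac{\exp\{-x^2/(4\nu t)\}}{4\pi\nu t}\right\}=\frac12\qquad\text{a.s.}$$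
   Context: In the constant-$\rho$ case the value of $\Gamma^{(\nu)}$ at the spatial origin is explicitly $$\Gamma^{(\nu)}_t(0,0)=p^{(\nu)}_t(0)\,p^{(\nu)}_t\left(\sqrt{\rho(0)}\,W_t\right)=\frac1{4\pi\nu t}\exp\left\{-\frac{\rho(0)W_t^2}{4\nu t}\right\}\qquad(t>0),$$ where $p^{(\nu)}_t(x)=(4\pi\nu t)^{-1/2}\exp(-x^2/(4\nu t))$; this is the (continuous) version used. Macroscopic Minkowski dimension: for $A\subset\mathbb{R}_+$ and integers $m\ge1$ let $\mathcal{C}_m(A)=\#\{j\in\{0,\ldots,m\}:[j,j+1]\cap A\ne\varnothing\}$, and $$\overline{\mathrm{Dim}}_{\rm M}(A)=\limsup_{m\to\infty}\frac{\log\mathcal{C}_m(A)}{\log m},\qquad\underline{\mathrm{Dim}}_{\rm M}(A)=\liminf_{m\to\infty}\frac{\log\mathcal{C}_m(A)}{\log m},$$ with the convention that the empty set has dimension $0$. When the two agree, the common value is denoted $\mathrm{Dim}_{\rm M}(A)$; a statement $\mathrm{Dim}_{\rm M}(A)=d$ includes the assertion that both equal $d$. *)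

theory Defs
  imports "HOL-Probability.Probability"
begin

section \<open>Macroscopic Minkowski dimension\<close>

definition unit_cells :: "nat \<Rightarrow> real set \<Rightarrow> nat" where
  "unit_cells m A = card {j \<in> {0..m}. {real j..real j + 1} \<inter> A \<noteq> {}}"

text \<open>The finitely many indices at which the quotient has a junk value (\<open>m \<le> 1\<close>, or no cell of
  a nonempty \<open>A\<close> met yet) do not affect the upper and lower limits.\<close>

definition upper_minkowski_dim :: "real set \<Rightarrow> ereal" where
  "upper_minkowski_dim A =
    (if A = {} then 0
     else limsup (\<lambda>m. ereal (ln (real (unit_cells m A)) / ln (real m))))"

definition lower_minkowski_dim :: "real set \<Rightarrow> ereal" where
  "lower_minkowski_dim A =
    (if A = {} then 0
     else liminf (\<lambda>m. ereal (ln (real (unit_cells m A)) / ln (real m))))"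

definition has_minkowski_dim :: "real set \<Rightarrow> real \<Rightarrow> bool" where
  "has_minkowski_dim A d \<longleftrightarrow>
    upper_minkowski_dim A = ereal d \<and> lower_minkowski_dim A = ereal d"


section \<open>Brownian motion\<close>

text \<open>The time index is real; only \<open>W t\<close> with \<open>t \<ge> 0\<close> is constrained.\<close>

definition standard_brownian_motion :: "'a measure \<Rightarrow> (real \<Rightarrow> 'a \<Rightarrow> real) \<Rightarrow> bool" where
  "standard_brownian_motion M W \<longleftrightarrow>
    prob_space M \<and>
    (\<forall>t\<ge>0. W t \<in> borel_measurable M) \<and>
    (AE \<omega> in M. W 0 \<omega> = 0) \<and>
    (\<forall>s t. 0 \<le> s \<longrightarrow> s < t \<longrightarrow>
      distributed M lborel (\<lambda>\<omega>. W t \<omega> - W s \<omega>) (normal_density 0 (sqrt (t - s)))) \<and>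
    (\<forall>n (\<tau> :: nat \<Rightarrow> real). 0 \<le> \<tau> 0 \<longrightarrow> (\<forall>i<n. \<tau> i \<le> \<tau> (Suc i)) \<longrightarrow>
      prob_space.indep_vars M (\<lambda>_. borel) (\<lambda>i \<omega>. W (\<tau> (Suc i)) \<omega> - W (\<tau> i) \<omega>) {..<n}) \<and>
    (AE \<omega> in M. continuous_on {0..} (\<lambda>t. W t \<omega>))"


section \<open>Stratonovich integral\<close>

definition tendsto_in_probability ::
    "'a measure \<Rightarrow> (nat \<Rightarrow> 'a \<Rightarrow> real) \<Rightarrow> ('a \<Rightarrow> real) \<Rightarrow> bool" where
  "tendsto_in_probability M S I \<longleftrightarrow>
    (\<forall>n. S n \<in> borel_measurable M) \<and> I \<in> borel_measurable M \<and>
    (\<forall>\<epsilon>>0. (\<lambda>n. measure M {\<omega> \<in> space M. \<bar>S n \<omega> - I \<omega>\<bar> > \<epsilon>}) \<longlonglongrightarrow> 0)"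

text \<open>The \<open>n\<close>-th partition of \<open>[s, t]\<close> has the points \<open>\<tau> n 0 \<le> \<dots> \<le> \<tau> n (k n)\<close>.\<close>

definition partitions_of ::
    "real \<Rightarrow> real \<Rightarrow> (nat \<Rightarrow> nat) \<Rightarrow> (nat \<Rightarrow> nat \<Rightarrow> real) \<Rightarrow> bool" where
  "partitions_of s t k \<tau> \<longleftrightarrow>
    (\<forall>n. \<tau> n 0 = s \<and> \<tau> n (k n) = t \<and> (\<forall>i<k n. \<tau> n i \<le> \<tau> n (Suc i))) \<and>
    (\<forall>\<delta>>0. \<forall>\<^sub>F n in sequentially. \<forall>i<k n. \<tau> n (Suc i) - \<tau> n i < \<delta>)"

text \<open>\<open>I\<close> is a version of the Fisk--Stratonovich integral \<open>\<integral>\<^sub>s\<^sup>t X\<^sub>r \<circ> dW\<^sub>r\<close>, the limit in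
  probability of the trapezoidal sums as the mesh tends to 0.\<close>

definition has_stratonovich_integral ::
    "'a measure \<Rightarrow> (real \<Rightarrow> 'a \<Rightarrow> real) \<Rightarrow> (real \<Rightarrow> 'a \<Rightarrow> real) \<Rightarrow> real \<Rightarrow> real \<Rightarrow>
      ('a \<Rightarrow> real) \<Rightarrow> bool" where
  "has_stratonovich_integral M W X s t I \<longleftrightarrow>
    (\<forall>k \<tau>. partitions_of s t k \<tau> \<longrightarrow>
      tendsto_in_probability M
        (\<lambda>n \<omega>. \<Sum>i<k n. (X (\<tau> n i) \<omega> + X (\<tau> n (Suc i)) \<omega>) / 2 *
                        (W (\<tau> n (Suc i)) \<omega> - W (\<tau> n i) \<omega>)) I)"


section \<open>The stochastic transport equation\<close>

text \<open>Partial derivatives of a field \<open>u t x y\<close> in the space variables.\<close>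

definition d_x :: "(real \<Rightarrow> real \<Rightarrow> real \<Rightarrow> real) \<Rightarrow> real \<Rightarrow> real \<Rightarrow> real \<Rightarrow> real" where
  "d_x u t x y = deriv (\<lambda>x'. u t x' y) x"

definition d_y :: "(real \<Rightarrow> real \<Rightarrow> real \<Rightarrow> real) \<Rightarrow> real \<Rightarrow> real \<Rightarrow> real \<Rightarrow> real" where
  "d_y u t x y = deriv (\<lambda>y'. u t x y') y"

definition continuous_field :: "(real \<Rightarrow> real \<Rightarrow> real \<Rightarrow> real) \<Rightarrow> bool" where
  "continuous_field u \<longleftrightarrow>
    continuous_on ({0<..} \<times> UNIV \<times> UNIV) (\<lambda>(t, x, y). u t x y)"

definition regular_field :: "(real \<Rightarrow> real \<Rightarrow> real \<Rightarrow> real) \<Rightarrow> bool" where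
  "regular_field u \<longleftrightarrow>
    (\<forall>t>0. \<forall>x y.
      (\<lambda>x'. u t x' y) differentiable (at x) \<and> (\<lambda>x'. d_x u t x' y) differentiable (at x) \<and>
      (\<lambda>y'. u t x y') differentiable (at y) \<and> (\<lambda>y'. d_y u t x y') differentiable (at y)) \<and>
    continuous_field u \<and>
    continuous_field (d_x u) \<and> continuous_field (d_y u) \<and>
    continuous_field (d_x (d_x u)) \<and> continuous_field (d_y (d_y u))"

text \<open>Weak convergence to \<open>\<delta>\<^sub>0 \<otimes> \<delta>\<^sub>0\<close> of the measures with densities \<open>u t\<close> as \<open>t\<close> decreases to 0.\<close>

definition starts_from_delta :: "(real \<Rightarrow> real \<Rightarrow> real \<Rightarrow> real) \<Rightarrow> bool" where
  "starts_from_delta u \<longleftrightarrow>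
    (\<forall>t>0. integrable lborel (\<lambda>(x, y). u t x y)) \<and>
    (\<forall>\<phi> :: real \<times> real \<Rightarrow> real. continuous_on UNIV \<phi> \<longrightarrow> bounded (range \<phi>) \<longrightarrow>
      ((\<lambda>t. LINT (x, y)|lborel. u t x y * \<phi> (x, y)) \<longlongrightarrow> \<phi> (0, 0)) (at_right 0))"

text \<open>\<open>\<theta> t x y \<omega>\<close> solves \<open>d\<theta> = \<nu> (\<partial>\<^sub>x\<^sup>2 + \<partial>\<^sub>y\<^sup>2) \<theta> dt + \<sigma> \<partial>\<^sub>y \<theta> \<circ> dW\<close> on
  \<open>(0, \<infinity>) \<times> \<real>\<^sup>2\<close>, written in integrated form over every \<open>[s, t]\<close> with \<open>s > 0\<close>, with
  \<open>\<theta>(0) = \<delta>\<^sub>0 \<otimes> \<delta>\<^sub>0\<close>.\<close>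

definition stratonovich_solution ::
    "'a measure \<Rightarrow> (real \<Rightarrow> 'a \<Rightarrow> real) \<Rightarrow> real \<Rightarrow> real \<Rightarrow>
      (real \<Rightarrow> real \<Rightarrow> real \<Rightarrow> 'a \<Rightarrow> real) \<Rightarrow> bool" where
  "stratonovich_solution M W \<nu> \<sigma> \<theta> \<longleftrightarrow>
    (\<forall>t>0. \<forall>x y. \<theta> t x y \<in> borel_measurable M) \<and>
    (AE \<omega> in M. regular_field (\<lambda>t x y. \<theta> t x y \<omega>)) \<and>
    (AE \<omega> in M. starts_from_delta (\<lambda>t x y. \<theta> t x y \<omega>)) \<and>
    (\<forall>s t x y. 0 < s \<longrightarrow> s < t \<longrightarrow>
      (\<exists>I. has_stratonovich_integral M W
             (\<lambda>r \<omega>. d_y (\<lambda>t x y. \<theta> t x y \<omega>) r x y) s t I \<and>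
        (AE \<omega> in M.
          let u = (\<lambda>t x y. \<theta> t x y \<omega>) in
          u t x y = u s x y
            + \<nu> * integral {s..t} (\<lambda>r. d_x (d_x u) r x y + d_y (d_y u) r x y)
            + \<sigma> * I \<omega>)))"

definition heat_kernel :: "real \<Rightarrow> real \<Rightarrow> real \<Rightarrow> real" where
  "heat_kernel \<nu> t x = (4 * pi * \<nu> * t) powr (- 1 / 2) * exp (- x\<^sup>2 / (4 * \<nu> * t))"

text \<open>\<open>\<Gamma>\<close> is the Stratonovich solution. Among all solutions it is singled out by its
  closed-form value at the spatial origin. That value is prescribed only almost surely for each
  fixed time; \<open>stratonovich_solution\<close> supplies the continuity in \<open>t\<close> that selects the version.\<close>

definition is_Gamma ::
    "'a measure \<Rightarrow> (real \<Rightarrow> 'a \<Rightarrow> real) \<Rightarrow> real \<Rightarrow> (real \<Rightarrow> real) \<Rightarrow>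
      (real \<Rightarrow> real \<Rightarrow> real \<Rightarrow> 'a \<Rightarrow> real) \<Rightarrow> bool" where
  "is_Gamma M W \<nu> \<rho> \<Gamma> \<longleftrightarrow>
    stratonovich_solution M W \<nu> (sqrt (\<rho> 0)) \<Gamma> \<and>
    (\<forall>t>0. AE \<omega> in M.
      \<Gamma> t 0 0 \<omega> = heat_kernel \<nu> t 0 * heat_kernel \<nu> t (sqrt (\<rho> 0) * W t \<omega>))"

end

theory Submission
  imports Defs "HOL-Real_Asymp.Real_Asymp"
begin

text \<open>At the spatial origin \<open>\<Gamma>\<close> is an explicit function of \<open>t\<close> and \<open>W t\<close>, so the two random sets are
  \<open>{t. \<bar>W t\<bar> < c * sqrt t}\<close> and \<open>{t. \<bar>W t\<bar> = b}\<close>. The dimensions are bounded from below by counting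
  integers \<open>j\<close> with \<open>\<bar>W j\<bar> < c * sqrt j\<close>, respectively those where \<open>W\<close> passes from \<open>(b - 1, b)\<close>
  above \<open>b\<close> within \<open>[j, j + 1]\<close> because of an increment larger than 1: such events at times
  \<open>i < j\<close> decorrelate as \<open>i / j\<close> tends to 0, and suitably weighted counts concentrate. The dimension
  of the level set is bounded from above because \<open>W\<close> oscillates by at most \<open>4 * j powr \<epsilon>\<close> on
  \<open>[j, j + 1]\<close> for all large \<open>j\<close>, whereas \<open>W j\<close> is that close to \<open>\<plusminus>b\<close> only with probability of order
  \<open>j powr (\<epsilon> - 1 / 2)\<close>.\<close>

section \<open>Counting cells by the second moment method\<close>

text \<open>The obstacle is that plain counts do not concentrate. By Brownian scaling, the numbers
  of good \<open>j\<close> up to \<open>m\<close>, divided by their means, keep nondegenerate limit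
  laws (an occupation time, respectively a local time), because pairs \<open>i\<close>,
  \<open>j\<close> of comparable size dominate the second moment. With the weights used below every
  dyadic range of times contributes the same amount to the mean and distant ranges are almost
  independent: mean and variance are then both of order ln m, so the variance is small against the
  squared mean.

  Null sets need care. One null set has to serve all \<open>K\<close> at once, which follows from
  monotonicity in the threshold \<open>c\<close> and a sequence of thresholds tending to 0. One null
  set also has to serve all times, which follows from rational times by continuity. Since
  \<open>W 0\<close> vanishes only almost surely, all estimates concern \<open>W t - W 0\<close>.
  For large \<open>K\<close> no probability is involved: the exponential is at most 1, so the set is
  empty.\<close>

lemma unit_cells_le: "unit_cells m A \<le> m + 1"
  unfolding unit_cells_def by (rule order_trans[OF card_mono[of "{0..m}"]]) auto

lemma eventually_unit_cells_le_powr: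
  assumes "\<beta> > 1"
  shows "\<forall>\<^sub>F m in sequentially. real (unit_cells m A) \<le> real m powr \<beta>"
proof -
  have "\<forall>\<^sub>F m in sequentially. real m + 1 \<le> real m powr \<beta>"
    using assms by real_asymp
  then show ?thesis
    by eventually_elim (use unit_cells_le[of _ A] in \<open>smt (verit) of_nat_1 of_nat_add of_nat_mono\<close>)
qed

text \<open>All exponents on either side of \<open>d\<close> are allowed, so constant factors, even
  random ones, are absorbed by a small change of exponent, and crude bounds on the count
  suffice.\<close>

lemma has_minkowski_dimI:
  assumes lower: "\<And>\<beta>. \<beta> < d \<Longrightarrow> \<forall>\<^sub>F m in sequentially. real m powr \<beta> \<le> real (unit_cells m A)"
    and upper: "\<And>\<beta>. \<beta> > d \<Longrightarrow> \<forall>\<^sub>F m in sequentially. real (unit_cells m A) \<le> real m powr \<beta>"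
  shows "has_minkowski_dim A d"
proof -
  define X where "X m = ln (real (unit_cells m A)) / ln (real m)" for m
  \<comment> \<open>Logarithms can be compared only once the count is positive. The same fact
    refutes \<open>A = {}\<close>, where the definitions return 0 instead of the limit.\<close>
  have pos: "\<forall>\<^sub>F m in sequentially. unit_cells m A > 0"
    using lower[of "d - 1", simplified] eventually_gt_at_top[of 0]
    by eventually_elim (auto intro: gr0I)
  have lo: "\<forall>\<^sub>F m in sequentially. \<beta> \<le> X m" if "\<beta> < d" for \<beta>
    using lower[OF that] pos eventually_gt_at_top[of 1]
  proof eventually_elim
    case (elim m)
    then have "ln (real m powr \<beta>) \<le> ln (real (unit_cells m A))"
      by (subst ln_le_cancel_iff) auto
    with elim show ?case by (simp add: X_def ln_powr field_simps)
  qed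
  have up: "\<forall>\<^sub>F m in sequentially. X m \<le> \<beta>" if "d < \<beta>" for \<beta>
    using upper[OF that] pos eventually_gt_at_top[of 1]
  proof eventually_elim
    case (elim m)
    then have "ln (real (unit_cells m A)) \<le> ln (real m powr \<beta>)"
      by (subst ln_le_cancel_iff) auto
    with elim show ?case by (simp add: X_def ln_powr field_simps)
  qed
  have "X \<longlonglongrightarrow> d"
  proof (rule order_tendstoI)
    fix a assume "a < d"
    then have "a < (a + d) / 2" "(a + d) / 2 < d" by auto
    then show "\<forall>\<^sub>F m in sequentially. a < X m"
      using lo[of "(a + d) / 2"] by (auto elim!: eventually_mono)
  next
    fix a assume "d < a"
    then have "(a + d) / 2 < a" "d < (a + d) / 2" by auto
    then show "\<forall>\<^sub>F m in sequentially. X m < a"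
      using up[of "(a + d) / 2"] by (auto elim!: eventually_mono)
  qed
  then have lim: "(\<lambda>m. ereal (X m)) \<longlonglongrightarrow> ereal d" by simp
  have "A \<noteq> {}"
  proof
    assume "A = {}"
    with eventually_happens[OF pos] show False by (auto simp: unit_cells_def)
  qed
  with lim_imp_Limsup[OF _ lim] lim_imp_Liminf[OF _ lim] show ?thesis
    unfolding has_minkowski_dim_def upper_minkowski_dim_def lower_minkowski_dim_def X_def by simp
qed

section \<open>Deterministic sums behind the variance bound\<close>

lemma sum_inverse_sqrt_le: "(\<Sum>i=1..n. 1 / sqrt (real i)) \<le> 2 * sqrt (real n)"
proof (induction n)
  case (Suc n)
  define s where "s = sqrt (real n)"
  define r where "r = sqrt (real (Suc n))"
  have sr: "s \<ge> 0" "r > 0" "r\<^sup>2 = s\<^sup>2 + 1" by (auto simp: s_def r_def)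
  have "0 \<le> (r - s)\<^sup>2" by simp
  with sr have "1 \<le> 2 * r * (r - s)" by (simp add: power2_eq_square algebra_simps)
  with sr have "1 / r \<le> 2 * (r - s)" by (simp add: field_simps)
  with Suc.IH show ?case unfolding r_def s_def by (simp add: algebra_simps)
qed simp

text \<open>Discrete counterpart of the Beta integral of 1 / sqrt (x (1 - x)) over (0, 1), whose
  value does not depend on the scale. The singularities at the two ends are separated by means of
  sqrt (i + k) \<le> sqrt i + sqrt k; the two resulting sums are mirror images of each
  other.\<close>

lemma sum_inverse_sqrt_mult_le:
  "(\<Sum>i=1..<j. 1 / sqrt (real i * (real j - real i))) \<le> 6"
proof (cases "j = 0")
  case False
  have j: "sqrt (real j) > 0" using False by simp
  have ge: "1 / sqrt (real i * (real j - real i))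
      \<le> sqrt 2 / sqrt (real j) * (1 / sqrt (real i) + 1 / sqrt (real (j - i)))"
    if i: "i \<in> {1..<j}" for i
  proof -
    define x y where "x = sqrt (real i)" and "y = sqrt (real (j - i))"
    have xy: "x > 0" "y > 0" "x\<^sup>2 + y\<^sup>2 = real j" using i by (auto simp: x_def y_def)
    have "sqrt (real j) \<le> x + y"
      using xy by (intro real_le_lsqrt) (auto simp: power2_sum)
    also have "\<dots> \<le> sqrt 2 * (x + y)" using xy by simp
    finally have "1 / (x * y) \<le> sqrt 2 / sqrt (real j) * (1 / x + 1 / y)"
      using xy j by (simp add: divide_simps mult_ac) (simp add: algebra_simps)
    moreover have "sqrt (real i * (real j - real i)) = x * y"
      using i by (simp add: x_def y_def real_sqrt_mult of_nat_diff)
    ultimately show ?thesis by (simp add: x_def y_def)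
  qed
  have flip: "(\<Sum>i=1..<j. 1 / sqrt (real (j - i))) = (\<Sum>i=1..<j. 1 / sqrt (real i))"
    by (rule sum.reindex_bij_witness[of _ "\<lambda>i. j - i" "\<lambda>i. j - i"]) auto
  have "(\<Sum>i=1..<j. 1 / sqrt (real i)) \<le> (\<Sum>i=1..j. 1 / sqrt (real i))"
    by (rule sum_mono2) auto
  also have "\<dots> \<le> 2 * sqrt (real j)" by (rule sum_inverse_sqrt_le)
  finally have le: "(\<Sum>i=1..<j. 1 / sqrt (real i)) \<le> 2 * sqrt (real j)" .
  have "(\<Sum>i=1..<j. 1 / sqrt (real i * (real j - real i)))
      \<le> (\<Sum>i=1..<j. sqrt 2 / sqrt (real j) * (1 / sqrt (real i) + 1 / sqrt (real (j - i))))"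
    by (rule sum_mono) (rule ge)
  also have "\<dots> = sqrt 2 / sqrt (real j) * (2 * (\<Sum>i=1..<j. 1 / sqrt (real i)))"
    unfolding sum_distrib_left[symmetric] sum.distrib flip by simp
  also have "\<dots> \<le> sqrt 2 / sqrt (real j) * (2 * (2 * sqrt (real j)))"
    using le j by (intro mult_left_mono) auto
  also have "\<dots> = 4 * sqrt 2" using j by simp
  also have "\<dots> \<le> 4 * (3 / 2)" by (intro mult_left_mono real_le_lsqrt) (auto simp: power2_eq_square)
  finally show ?thesis by simp
qed simp

text \<open>Enlarging the square by one index adds a row and a column, equal by symmetry, and a
  corner. Each index \<open>j\<close> therefore costs at most
  \<open>2 * D * c j + c j\<close>.\<close>

lemma double_sum_le:
  fixes a :: "nat \<Rightarrow> nat \<Rightarrow> real"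
  assumes sym: "\<And>i j. a i j = a j i"
    and diag: "\<And>j. m \<le> j \<Longrightarrow> a j j \<le> c j"
    and off: "\<And>j. m \<le> j \<Longrightarrow> (\<Sum>i=m..<j. a i j) \<le> D * c j"
    and "m \<le> n"
  shows "(\<Sum>i=m..<n. \<Sum>j=m..<n. a i j) \<le> (1 + 2 * D) * (\<Sum>j=m..<n. c j)"
  using \<open>m \<le> n\<close>
proof (induction n rule: dec_induct)
  case (step n)
  have "(\<Sum>i=m..<Suc n. \<Sum>j=m..<Suc n. a i j)
      = (\<Sum>i=m..<n. \<Sum>j=m..<n. a i j) + 2 * (\<Sum>i=m..<n. a i n) + a n n"
  proof -
    have "(\<Sum>j=m..<n. a n j) = (\<Sum>i=m..<n. a i n)" by (intro sum.cong refl sym)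
    with step show ?thesis by (simp add: sum.distrib)
  qed
  also have "\<dots> \<le> (1 + 2 * D) * (\<Sum>j=m..<n. c j) + 2 * (D * c n) + c n"
    using step.IH step.hyps off[of n] diag[of n] by simp
  finally show ?case using step by (simp add: algebra_simps)
qed simp

lemma ln_le_sum_inverse:
  assumes "1 \<le> m" "m \<le> n"
  shows "ln (real n / real m) \<le> (\<Sum>j=m..<n. 1 / real j)"
  using assms(2)
proof (induction n rule: dec_induct)
  case (step n)
  have n: "n \<ge> 1" using step assms by simp
  have "ln (real (Suc n) / real m) = ln (real n / real m) + ln (1 + 1 / real n)"
  proof -
    have "real (Suc n) / real m = real n / real m * (1 + 1 / real n)"
      using n assms by (simp add: field_simps)
    moreover have "0 < real n / real m" "0 < 1 + 1 / real n" using n assms by (auto intro: add_pos_nonneg)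
    ultimately show ?thesis by (simp only: ln_mult_pos)
  qed
  also have "ln (1 + 1 / real n) \<le> 1 / real n"
    by (rule ln_add_one_self_le_self) simp
  finally show ?case using step by simp
qed (use assms in simp)

section \<open>Weighted counts of dependent events\<close>

context prob_space
begin

text \<open>Summed over \<open>i < j\<close>, the assumed covariance bound gives at most
  \<open>6 * C / j\<close> by the Beta-type estimate. This has the order of the diagonal term
  \<open>(w j)\<^sup>2\<close>, so up to a constant the variance is as small as for independent
  events.\<close>

lemma variance_weighted_indicators_le:
  fixes J :: "nat \<Rightarrow> 'a set" and w :: "nat \<Rightarrow> real"
  assumes J: "\<And>j. J j \<in> events"
    and w: "\<And>j. 1 \<le> j \<Longrightarrow> (w j)\<^sup>2 \<le> 1 / real j"
    and C: "0 \<le> C"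
    and cov: "\<And>i j. 1 \<le> i \<Longrightarrow> i < j \<Longrightarrow>
      w i * w j * (prob (J i \<inter> J j) - prob (J i) * prob (J j))
        \<le> C / (real j * sqrt (real i * (real j - real i)))"
    and mn: "1 \<le> m" "m \<le> n"
  shows "variance (\<lambda>\<omega>. \<Sum>j=m..<n. w j * indicator (J j) \<omega>)
    \<le> (1 + 12 * C) * (\<Sum>j=m..<n. 1 / real j)"
proof -
  define S where "S \<omega> = (\<Sum>j=m..<n. w j * indicator (J j) \<omega>)" for \<omega>
  define a where "a i j = w i * w j * (prob (J i \<inter> J j) - prob (J i) * prob (J j))" for i j
  note [measurable] = J
  have ind: "integrable M (indicator B :: 'a \<Rightarrow> real)" if "B \<in> events" for B
    using that by (simp add: integrable_real_indicator emeasure_eq_measure)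
  then have int: "integrable M (\<lambda>\<omega>. c * indicator B \<omega> :: real)" if "B \<in> events" for B c
    using that by simp
  have S2: "(S \<omega>)\<^sup>2 = (\<Sum>i=m..<n. \<Sum>j=m..<n. (w i * w j) * indicator (J i \<inter> J j) \<omega>)" for \<omega>
    unfolding S_def power2_eq_square sum_product
    by (intro sum.cong refl) (simp add: indicator_inter_arith)
  have E: "expectation S = (\<Sum>j=m..<n. w j * prob (J j))"
    unfolding S_def by (subst Bochner_Integration.integral_sum) (auto simp: ind)
  have E2: "expectation (\<lambda>\<omega>. (S \<omega>)\<^sup>2)
      = (\<Sum>i=m..<n. \<Sum>j=m..<n. (w i * w j) * prob (J i \<inter> J j))"
  proof -
    have "expectation (\<lambda>\<omega>. (S \<omega>)\<^sup>2)
        = (\<Sum>i=m..<n. expectation (\<lambda>\<omega>. \<Sum>j=m..<n. (w i * w j) * indicator (J i \<inter> J j) \<omega>))"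
      unfolding S2 by (intro Bochner_Integration.integral_sum Bochner_Integration.integrable_sum int sets.Int J)
    also have "\<dots> = (\<Sum>i=m..<n. \<Sum>j=m..<n. expectation (\<lambda>\<omega>. (w i * w j) * indicator (J i \<inter> J j) \<omega>))"
      by (intro sum.cong refl Bochner_Integration.integral_sum int sets.Int J)
    finally show ?thesis by (simp add: ind)
  qed
  have "variance S = expectation (\<lambda>\<omega>. (S \<omega>)\<^sup>2) - (expectation S)\<^sup>2"
  proof (rule variance_eq)
    show "integrable M S" unfolding S_def
      by (intro Bochner_Integration.integrable_sum int J)
    show "integrable M (\<lambda>\<omega>. (S \<omega>)\<^sup>2)" unfolding S2
      by (intro Bochner_Integration.integrable_sum int sets.Int J)
  qed
  also have "\<dots> = (\<Sum>i=m..<n. \<Sum>j=m..<n. a i j)"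
  proof -
    have "(expectation S)\<^sup>2 = (\<Sum>i=m..<n. \<Sum>j=m..<n. w i * prob (J i) * (w j * prob (J j)))"
      unfolding E power2_eq_square sum_product ..
    then show ?thesis
      unfolding E2 a_def by (simp add: sum_subtractf[symmetric] algebra_simps)
  qed
  also have "\<dots> \<le> (1 + 2 * (6 * C)) * (\<Sum>j=m..<n. 1 / real j)"
  proof (rule double_sum_le)
    show "a i j = a j i" for i j by (simp add: a_def Int_commute mult_ac)
    show "a j j \<le> 1 / real j" if "m \<le> j" for j
    proof -
      have "prob (J j) - prob (J j) * prob (J j) \<le> 1" by (smt (verit) prob_le_1 mult_nonneg_nonneg measure_nonneg)
      then have "a j j \<le> (w j)\<^sup>2 * 1"
        unfolding a_def power2_eq_square by (intro mult_left_mono) auto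
      with w[of j] that mn show ?thesis by simp
    qed
    show "(\<Sum>i=m..<j. a i j) \<le> 6 * C * (1 / real j)" if "m \<le> j" for j
    proof -
      have "(\<Sum>i=m..<j. a i j) \<le> (\<Sum>i=m..<j. C / real j * (1 / sqrt (real i * (real j - real i))))"
        using cov mn unfolding a_def by (intro sum_mono) simp
      also have "\<dots> \<le> (\<Sum>i=1..<j. C / real j * (1 / sqrt (real i * (real j - real i))))"
        using mn C by (intro sum_mono2) (auto intro!: divide_nonneg_nonneg mult_nonneg_nonneg)
      also have "\<dots> \<le> C / real j * 6"
        unfolding sum_distrib_left[symmetric] using C
        by (intro mult_left_mono sum_inverse_sqrt_mult_le) auto
      finally show ?thesis by (simp add: mult.commute)
    qed
  qed (rule mn)
  finally show ?thesis unfolding S_def[abs_def] by simp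
qed

text \<open>Weighting the \<open>j\<close>-th indicator by \<open>j powr - \<alpha>\<close> makes mean and variance of a block sum
  comparable to the harmonic sum of the block. Over the blocks from \<open>2 ^ i ^ 3\<close> to
  \<open>2 ^ (i + 1) ^ 3\<close> the latter is at least \<open>i\<^sup>2\<close>, so Chebyshev's bounds are summable, while the
  block ends remain logarithmically dense.\<close>

lemma AE_eventually_powr_le_card:
  fixes J :: "nat \<Rightarrow> 'a set"
  assumes J: "\<And>j. J j \<in> events"
    and \<alpha>: "1 / 2 \<le> \<alpha>" and c: "0 < c" and C: "0 \<le> C"
    and mean: "\<And>j. 1 \<le> j \<Longrightarrow> c * real j powr (\<alpha> - 1) \<le> prob (J j)"
    and cov: "\<And>i j. 1 \<le> i \<Longrightarrow> i < j \<Longrightarrow>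
      prob (J i \<inter> J j) - prob (J i) * prob (J j)
        \<le> C * (real i * real j) powr \<alpha> / (real j * sqrt (real i * (real j - real i)))"
  shows "AE \<omega> in M. \<forall>\<beta><\<alpha>. \<forall>\<^sub>F m in sequentially.
    real m powr \<beta> \<le> real (card {j \<in> {1..m}. \<omega> \<in> J j})"
proof -
  define w :: "nat \<Rightarrow> real" where "w j = real j powr - \<alpha>" for j
  define b :: "nat \<Rightarrow> nat" where "b i = 2 ^ i ^ 3" for i
  define T where "T i \<omega> = (\<Sum>j=b i..<b (Suc i). w j * indicator (J j) \<omega>)" for i and \<omega> :: 'a
  define H where "H i = (\<Sum>j=b i..<b (Suc i). 1 / real j)" for i
  note [measurable] = J
  have b1: "1 \<le> b i" for i by (simp add: b_def)
  have b_mono: "b i \<le> b j" if "i \<le> j" for i j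
    unfolding b_def using that by (intro power_increasing power_mono) auto
  have H: "(real i)\<^sup>2 \<le> H i" for i
  proof -
    have "real (Suc i ^ 3) - real (i ^ 3) = 3 * (real i)\<^sup>2 + 3 * real i + 1"
      by (simp add: power2_eq_square power3_eq_cube algebra_simps)
    then have d: "2 * (real i)\<^sup>2 \<le> real (Suc i ^ 3) - real (i ^ 3)" by simp
    have "1 / 2 \<le> ln (2::real)" using ln_le_minus_one[of "1 / 2 :: real"] by (simp add: ln_div)
    with d have "2 * (real i)\<^sup>2 * (1 / 2) \<le> (real (Suc i ^ 3) - real (i ^ 3)) * ln 2"
      by (intro mult_mono) auto
    also have "\<dots> = ln (real (b (Suc i)) / real (b i))"
      unfolding b_def by (simp add: ln_div ln_realpow algebra_simps del: power_Suc)
    also have "\<dots> \<le> H i"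
      unfolding H_def using b1[of i] b_mono[of i "Suc i"] by (intro ln_le_sum_inverse) auto
    finally show ?thesis by simp
  qed
  have var: "variance (T i) \<le> (1 + 12 * C) * H i" for i
    unfolding T_def[abs_def] H_def
  proof (rule variance_weighted_indicators_le)
    show "(w j)\<^sup>2 \<le> 1 / real j" if "1 \<le> j" for j
    proof -
      have "(w j)\<^sup>2 = real j powr (- (2 * \<alpha>))" by (simp add: w_def power2_eq_square powr_add[symmetric])
      also have "\<dots> \<le> real j powr - 1" using that \<alpha> by (intro powr_mono) auto
      also have "\<dots> = 1 / real j" using that by (simp add: powr_minus_divide)
      finally show ?thesis .
    qed
    show "w i * w j * (prob (J i \<inter> J j) - prob (J i) * prob (J j))
        \<le> C / (real j * sqrt (real i * (real j - real i)))" if "1 \<le> i" "i < j" for i j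
    proof -
      have eq: "w i * w j * (real i * real j) powr \<alpha> = 1"
        using that by (simp add: w_def powr_mult powr_minus field_simps)
      have "w i * w j * (prob (J i \<inter> J j) - prob (J i) * prob (J j))
        \<le> w i * w j * (C * (real i * real j) powr \<alpha> / (real j * sqrt (real i * (real j - real i))))"
        by (intro mult_left_mono cov that) (simp add: w_def)
      also have "\<dots> = (w i * w j * (real i * real j) powr \<alpha>) * C / (real j * sqrt (real i * (real j - real i)))"
        by simp
      finally show ?thesis unfolding eq by simp
    qed
  qed (use J C b1 b_mono in auto)
  have mean_T: "c * H i \<le> expectation (T i)" for i
  proof -
    have "c * H i = (\<Sum>j=b i..<b (Suc i). c * (1 / real j))"
      unfolding H_def by (rule sum_distrib_left)
    also have "\<dots> \<le> (\<Sum>j=b i..<b (Suc i). w j * prob (J j))"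
    proof (rule sum_mono)
      fix j assume "j \<in> {b i..<b (Suc i)}"
      with b1[of i] have j: "1 \<le> j" by simp
      have "c * (1 / real j) = w j * (c * real j powr (\<alpha> - 1))"
        using j by (simp add: w_def powr_diff powr_minus field_simps)
      also have "\<dots> \<le> w j * prob (J j)" by (intro mult_left_mono mean j) (simp add: w_def)
      finally show "c * (1 / real j) \<le> w j * prob (J j)" .
    qed
    also have "\<dots> = expectation (T i)"
      unfolding T_def
      by (subst Bochner_Integration.integral_sum)
         (auto simp: integrable_real_indicator emeasure_eq_measure)
    finally show ?thesis .
  qed
  have T_meas [measurable]: "random_variable borel (T i)" for i
    unfolding T_def[abs_def] by measurable
  have int_T2: "integrable M (\<lambda>\<omega>. (T i \<omega>)\<^sup>2)" for i
  proof (rule integrable_const_bound[where B = "(\<Sum>j=b i..<b (Suc i). w j)\<^sup>2"])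
    have "0 \<le> T i \<omega>" "T i \<omega> \<le> (\<Sum>j=b i..<b (Suc i). w j)" for \<omega>
      unfolding T_def by (intro sum_nonneg sum_mono; simp add: w_def indicator_def)+
    then show "AE \<omega> in M. norm ((T i \<omega>)\<^sup>2) \<le> (\<Sum>j=b i..<b (Suc i). w j)\<^sup>2"
      by (auto intro!: AE_I2 power_mono)
  qed measurable
  \<comment> \<open>The allowed deviation is half of the guaranteed mean \<open>c * H i\<close>. Off
    \<open>B i\<close> the block sum is at least \<open>c / 2 * H i\<close>, and since the variance
    is at most linear in \<open>H i\<close>, Chebyshev leaves a bound of order
    \<open>1 / H i\<close>.\<close>
  define B where "B i = {\<omega> \<in> space M. \<bar>T i \<omega> - expectation (T i)\<bar> \<ge> c / 2 * H i}" for i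
  have B_meas [measurable]: "B i \<in> events" for i unfolding B_def by measurable
  define D where "D = 4 * (1 + 12 * C) / c\<^sup>2"
  have prob_B: "prob (B i) \<le> D * inverse ((real i)\<^sup>2)" if "i \<ge> 1" for i
  proof -
    have Hpos: "H i > 0" using H[of i] that by (smt (verit) of_nat_0_less_iff less_le_trans zero_less_power zero_less_one)
    have "prob (B i) \<le> variance (T i) / (c / 2 * H i)\<^sup>2"
      unfolding B_def by (rule Chebyshev_inequality) (use int_T2 c Hpos in auto)
    also have "\<dots> \<le> (1 + 12 * C) * H i / (c / 2 * H i)\<^sup>2"
      by (intro divide_right_mono var) simp
    also have "\<dots> = D * inverse (H i)"
      using Hpos c by (simp add: D_def power2_eq_square field_simps)
    also have "\<dots> \<le> D * inverse ((real i)\<^sup>2)"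
      using H[of i] that C by (intro mult_left_mono le_imp_inverse_le) (auto simp: D_def)
    finally show ?thesis .
  qed
  have "summable (\<lambda>i. prob (B i))"
  proof (rule summable_comparison_test_ev)
    show "summable (\<lambda>i. D * inverse ((real i)\<^sup>2))"
      using inverse_power_summable[of 2, where 'a = real] by (intro summable_mult) simp
    show "\<forall>\<^sub>F i in sequentially. norm (prob (B i)) \<le> D * inverse ((real i)\<^sup>2)"
      using eventually_ge_at_top[of 1] by eventually_elim (use prob_B in simp)
  qed
  then have "AE \<omega> in M. \<forall>\<^sub>F i in sequentially. \<omega> \<in> space M - B i"
    by (intro borel_cantelli_AE1) (auto simp: emeasure_eq_measure)
  then show ?thesis
  proof eventually_elim
    case (elim \<omega>)
    have "filterlim (\<lambda>i. c / 2 * (real i)\<^sup>2) at_top sequentially"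
      using c by real_asymp
    then have "\<forall>\<^sub>F i in sequentially. 1 \<le> c / 2 * (real i)\<^sup>2"
      unfolding filterlim_at_top by blast
    with elim have "\<forall>\<^sub>F i in sequentially. 1 \<le> T i \<omega>"
    proof eventually_elim
      case (elim i)
      have "1 \<le> c / 2 * H i" using elim(2) H[of i] c
        by (smt (verit) mult_left_mono half_gt_zero)
      moreover have "\<bar>T i \<omega> - expectation (T i)\<bar> < c / 2 * H i"
        using elim(1) by (simp add: B_def not_le)
      ultimately show ?case using mean_T[of i] by linarith
    qed
    then obtain I where I: "\<And>i. i \<ge> I \<Longrightarrow> 1 \<le> T i \<omega>" by (auto simp: eventually_sequentially)
    define N where "N m = card {j \<in> {1..m}. \<omega> \<in> J j}" for m
    \<comment> \<open>No weight in block \<open>i\<close> exceeds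
      \<open>b i powr - \<alpha>\<close>, so a weighted sum of at least 1 forces at least
      \<open>b i powr \<alpha>\<close> hits.\<close>
    have N: "real (b i) powr \<alpha> \<le> real (N m)" if "i \<ge> I" "b (Suc i) \<le> m" for i m
    proof -
      have "1 \<le> T i \<omega>" by (rule I) fact
      also have "T i \<omega> = (\<Sum>j | j \<in> {b i..<b (Suc i)} \<and> \<omega> \<in> J j. w j)"
        unfolding T_def by (rule sum.mono_neutral_cong_right) auto
      also have "\<dots> \<le> (\<Sum>j | j \<in> {b i..<b (Suc i)} \<and> \<omega> \<in> J j. real (b i) powr - \<alpha>)"
        unfolding w_def using b1[of i] \<alpha> by (intro sum_mono powr_mono2') auto
      also have "\<dots> = real (card {j \<in> {b i..<b (Suc i)}. \<omega> \<in> J j}) * real (b i) powr - \<alpha>"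
        by simp
      also have "card {j \<in> {b i..<b (Suc i)}. \<omega> \<in> J j} \<le> N m"
        unfolding N_def using that b1[of i] by (intro card_mono) auto
      finally have "1 \<le> real (N m) * real (b i) powr - \<alpha>"
        by (simp add: mult_right_mono)
      then show ?thesis using b1[of i] by (simp add: powr_minus field_simps)
    qed
    show ?case
    proof (intro allI impI)
      fix \<beta> assume "\<beta> < \<alpha>"
      \<comment> \<open>The estimate below raises an upper bound for \<open>m\<close> to this power,
        which needs a nonnegative exponent, whereas \<open>\<beta>\<close> may be negative.\<close>
      define \<gamma> where "\<gamma> = max \<beta> 0"
      have \<gamma>: "0 \<le> \<gamma>" "\<gamma> < \<alpha>" "\<beta> \<le> \<gamma>" using \<open>\<beta> < \<alpha>\<close> \<alpha> by (auto simp: \<gamma>_def)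
      \<comment> \<open>If block \<open>i\<close> is the last one complete by time \<open>m\<close>,
        then \<open>m\<close> may be almost \<open>b (i + 2)\<close>, while only
        \<open>b i powr \<alpha>\<close> hits are guaranteed. The ratio of the cubes of
        \<open>i + 2\<close> and \<open>i\<close> tends to 1, so the gap between
        \<open>\<gamma>\<close> and \<open>\<alpha>\<close> pays for the loss; exponents growing
        geometrically would not allow this.\<close>
      have "\<forall>\<^sub>F i in sequentially. (real i + 2) ^ 3 * \<gamma> \<le> real i ^ 3 * \<alpha>"
        using \<gamma> by real_asymp
      then obtain I' where I': "\<And>i. i \<ge> I' \<Longrightarrow> (real i + 2) ^ 3 * \<gamma> \<le> real i ^ 3 * \<alpha>"
        by (auto simp: eventually_sequentially)
      define K where "K = max I I'"
      have "real m powr \<beta> \<le> real (N m)" if m: "m \<ge> b (Suc K)" for m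
      proof -
        \<comment> \<open>Bounds the admissible indices, so that the \<open>GREATEST\<close> below
          is attained.\<close>
        have lim: "m < b m"
        proof -
          have "m \<le> m ^ 3" by (cases "m = 0") (auto intro: self_le_power)
          also have "m ^ 3 < 2 ^ (m ^ 3)" by (rule less_exp)
          finally show ?thesis by (simp add: b_def)
        qed
        define i where "i = (GREATEST i. b (Suc i) \<le> m)"
        have bound: "\<forall>i. b (Suc i) \<le> m \<longrightarrow> i \<le> m"
        proof (intro allI impI)
          fix i assume "b (Suc i) \<le> m"
          show "i \<le> m"
          proof (rule ccontr)
            assume "\<not> i \<le> m"
            then have "b m \<le> b (Suc i)" by (intro b_mono) simp
            with \<open>b (Suc i) \<le> m\<close> lim show False by simp
          qed
        qed
        have i: "b (Suc i) \<le> m" unfolding i_def by (rule GreatestI_nat[where b = m]) (use m bound in auto)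
        have Ki: "K \<le> i" unfolding i_def by (rule Greatest_le_nat[where b = m]) (use m bound in auto)
        have "\<not> b (Suc (Suc i)) \<le> m"
        proof
          assume "b (Suc (Suc i)) \<le> m"
          then have "Suc i \<le> i" unfolding i_def
            by (rule Greatest_le_nat[where b = m]) (use bound in auto)
          then show False by simp
        qed
        then have "real m \<le> real (b (Suc (Suc i)))" by simp
        also have "\<dots> = 2 powr real (Suc (Suc i) ^ 3)"
          unfolding b_def by (subst powr_realpow) auto
        also have "real (Suc (Suc i) ^ 3) = (real i + 2) ^ 3" by (simp add: add.commute)
        finally have m_le: "real m \<le> 2 powr ((real i + 2) ^ 3)" .
        have m1: "1 \<le> m" using m b1[of "Suc K"] by simp
        have "real m powr \<beta> \<le> real m powr \<gamma>" using m1 \<gamma> by (intro powr_mono) auto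
        also have "\<dots> \<le> (2 powr ((real i + 2) ^ 3)) powr \<gamma>"
          using m_le \<gamma> by (intro powr_mono2) auto
        also have "\<dots> = 2 powr ((real i + 2) ^ 3 * \<gamma>)" by (simp add: powr_powr)
        also have "\<dots> \<le> 2 powr (real i ^ 3 * \<alpha>)"
          using I'[of i] Ki by (intro powr_mono) (auto simp: K_def)
        also have "\<dots> = real (b i) powr \<alpha>"
        proof -
          have "real (b i) = 2 powr real (i ^ 3)" unfolding b_def by (subst powr_realpow) auto
          then show ?thesis by (simp add: powr_powr)
        qed
        also have "\<dots> \<le> real (N m)" using Ki i by (intro N) (auto simp: K_def)
        finally show ?thesis .
      qed
      then show "\<forall>\<^sub>F m in sequentially. real m powr \<beta> \<le> real (card {j \<in> {1..m}. \<omega> \<in> J j})"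
        unfolding N_def eventually_sequentially by blast
    qed
  qed
qed

end

section \<open>Gaussian estimates and Brownian increments\<close>

definition gauss :: "real measure" where
  "gauss = density lborel std_normal_density"

lemma sets_gauss [measurable_cong, simp]: "sets gauss = sets borel"
  by (simp add: gauss_def)

lemma space_gauss [simp]: "space gauss = UNIV"
  by (simp add: gauss_def)

interpretation gauss: prob_space gauss
  unfolding gauss_def by (rule prob_space_normal_density) simp

lemma std_normal_density_le: "std_normal_density x \<le> 1 / sqrt (2 * pi)"
  by (simp add: std_normal_density_def divide_right_mono)

lemma gauss_le:
  assumes "A \<subseteq> {a..b}" "a \<le> b" and [measurable]: "A \<in> sets borel"
  shows "measure gauss A \<le> (b - a) / sqrt (2 * pi)"
proof -
  have "emeasure gauss A = (\<integral>\<^sup>+x. ennreal (std_normal_density x) * indicator A x \<partial>lborel)"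
    unfolding gauss_def by (subst emeasure_density) auto
  also have "\<dots> \<le> (\<integral>\<^sup>+x. ennreal (1 / sqrt (2 * pi)) * indicator {a..b} x \<partial>lborel)"
    using assms(1) std_normal_density_le
    by (intro nn_integral_mono mult_mono ennreal_leI) (auto simp: indicator_def)
  also have "\<dots> = ennreal ((b - a) / sqrt (2 * pi))"
    using assms(2) by (simp add: nn_integral_cmult_indicator ennreal_mult'[symmetric])
  finally show ?thesis
    using assms(2) by (simp add: gauss.emeasure_eq_measure)
qed

lemma gauss_ge:
  assumes "{a<..<b} \<subseteq> A" "a \<le> b" "\<bar>a\<bar> \<le> r" "\<bar>b\<bar> \<le> r" and [measurable]: "A \<in> sets borel"
  shows "(b - a) / sqrt (2 * pi) * exp (- r\<^sup>2 / 2) \<le> measure gauss A"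
proof -
  have le: "1 / sqrt (2 * pi) * exp (- r\<^sup>2 / 2) \<le> std_normal_density x" if "a < x" "x < b" for x
  proof -
    have "\<bar>x\<bar> \<le> \<bar>r\<bar>" using that assms by auto
    then have "x\<^sup>2 \<le> r\<^sup>2" by (simp add: abs_le_square_iff)
    then show ?thesis by (simp add: std_normal_density_def divide_right_mono)
  qed
  have "ennreal ((b - a) / sqrt (2 * pi) * exp (- r\<^sup>2 / 2))
    = (\<integral>\<^sup>+x. ennreal (1 / sqrt (2 * pi) * exp (- r\<^sup>2 / 2)) * indicator {a<..<b} x \<partial>lborel)"
    using assms(2) by (subst nn_integral_cmult_indicator) (auto simp: ennreal_mult'[symmetric] mult_ac)
  also have "\<dots> \<le> (\<integral>\<^sup>+x. ennreal (std_normal_density x) * indicator A x \<partial>lborel)"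
    using assms(1) le by (intro nn_integral_mono) (auto simp: indicator_def intro!: ennreal_leI)
  also have "\<dots> = emeasure gauss A"
    unfolding gauss_def by (subst emeasure_density) auto
  finally show ?thesis
    by (simp add: gauss.emeasure_eq_measure)
qed

text \<open>Markov's inequality for the power \<open>2 * q\<close>; the quotient of factorials is
  the Gaussian moment (2q - 1)!!. Leaving \<open>q\<close> free allows a polynomial decay of any
  order.\<close>

lemma gauss_tail_le:
  assumes "0 < c"
  shows "measure gauss {x. c < \<bar>x\<bar>} \<le> fact (2 * q) / (2 ^ q * fact q) / c ^ (2 * q)"
proof -
  let ?m = "fact (2 * q) / (2 ^ q * fact q) :: real"
  have int: "integrable lborel (\<lambda>x. std_normal_density x * x ^ (2 * q))"
    by (rule integrable_std_normal_moment)
  have "emeasure gauss {x. c < \<bar>x\<bar>}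
    = (\<integral>\<^sup>+x. ennreal (std_normal_density x) * indicator {x. c < \<bar>x\<bar>} x \<partial>lborel)"
    unfolding gauss_def by (subst emeasure_density) auto
  also have "\<dots> \<le> (\<integral>\<^sup>+x. ennreal (1 / c ^ (2 * q)) * ennreal (std_normal_density x * x ^ (2 * q)) \<partial>lborel)"
  proof (rule nn_integral_mono)
    fix x :: real
    have "std_normal_density x \<le> 1 / c ^ (2 * q) * (std_normal_density x * x ^ (2 * q))" if "c < \<bar>x\<bar>"
    proof -
      have "c ^ (2 * q) \<le> \<bar>x\<bar> ^ (2 * q)" using that assms by (intro power_mono) auto
      then have "c ^ (2 * q) \<le> x ^ (2 * q)" by (simp add: power_even_abs)
      then have "std_normal_density x * 1 \<le> std_normal_density x * (x ^ (2 * q) / c ^ (2 * q))"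
        using assms by (intro mult_left_mono) (auto simp: normal_density_nonneg)
      then show ?thesis by simp
    qed
    then show "ennreal (std_normal_density x) * indicator {x. c < \<bar>x\<bar>} x
      \<le> ennreal (1 / c ^ (2 * q)) * ennreal (std_normal_density x * x ^ (2 * q))"
      using assms by (auto simp: indicator_def ennreal_mult'[symmetric] intro!: ennreal_leI)
  qed
  also have "\<dots> = ennreal (1 / c ^ (2 * q)) * ennreal ?m"
    using int by (subst nn_integral_cmult)
      (auto simp: nn_integral_eq_integral integral_std_normal_moment_even normal_density_nonneg)
  also have "\<dots> = ennreal (?m / c ^ (2 * q))"
    using assms by (simp add: ennreal_mult'[symmetric])
  finally show ?thesis
    using assms by (simp add: gauss.emeasure_eq_measure)
qed

section \<open>Standardization, and conditioning on an independent variable\<close>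

context prob_space
begin

lemma prob_normal:
  assumes D: "distributed M lborel Y (normal_density 0 \<sigma>)" and \<sigma>: "0 < \<sigma>"
    and [measurable]: "A \<in> sets borel"
  shows "\<P>(\<omega> in M. Y \<omega> / \<sigma> \<in> A) = measure gauss A"
proof -
  have D': "distributed M lborel (\<lambda>\<omega>. Y \<omega> / \<sigma>) std_normal_density"
    using normal_standard_normal_convert[OF \<sigma>, of Y 0] D by simp
  have [measurable]: "(\<lambda>\<omega>. Y \<omega> / \<sigma>) \<in> borel_measurable M"
    using distributed_measurable[OF D'] by simp
  have "measure gauss A = measure (distr M lborel (\<lambda>\<omega>. Y \<omega> / \<sigma>)) A"
    unfolding gauss_def distributed_distr_eq_density[OF D'] ..
  also have "\<dots> = \<P>(\<omega> in M. Y \<omega> / \<sigma> \<in> A)"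
    by (subst measure_distr) (auto intro!: arg_cong[where f = prob])
  finally show ?thesis ..
qed

text \<open>Freezing \<open>U\<close> by Fubini on the product of the two laws replaces conditional
  probabilities. With the past in \<open>U\<close> and later increments in \<open>V\<close>, this is
  the form in which the Markov property of Brownian motion is used.\<close>

lemma prob_indep_section_le:
  assumes ind: "indep_var N1 U N2 V"
    and E [measurable]: "E \<in> sets N1" and G [measurable]: "G \<in> sets (N1 \<Otimes>\<^sub>M N2)"
    and q: "\<And>u. u \<in> space N1 \<Longrightarrow> \<P>(\<omega> in M. (u, V \<omega>) \<in> G) \<le> q"
  shows "\<P>(\<omega> in M. U \<omega> \<in> E \<and> (U \<omega>, V \<omega>) \<in> G) \<le> q * \<P>(\<omega> in M. U \<omega> \<in> E)"
proof -
  have U [measurable]: "U \<in> measurable M N1" and V [measurable]: "V \<in> measurable M N2"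
    using ind by (auto dest: indep_var_rv1 indep_var_rv2)
  interpret V: prob_space "distr M N2 V" by (rule prob_space_distr) fact
  define F where "F = E \<times> space N2 \<inter> G"
  have [measurable]: "F \<in> sets (N1 \<Otimes>\<^sub>M N2)" unfolding F_def by measurable
  have q0: "0 \<le> q" if "u \<in> space N1" for u
    using q[OF that] by (rule order_trans[OF measure_nonneg])
  have sec: "emeasure (distr M N2 V) (Pair u -` F) \<le> ennreal q * indicator E u" if u: "u \<in> space N1" for u
  proof (cases "u \<in> E")
    case True
    have "Pair u -` F \<in> sets N2" by (rule sets_Pair1) measurable
    then have "emeasure (distr M N2 V) (Pair u -` F) = emeasure M {\<omega> \<in> space M. (u, V \<omega>) \<in> G}"
      using True by (subst emeasure_distr)
        (auto simp: F_def intro!: arg_cong[where f = "emeasure M"] dest: measurable_space[OF V])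
    with ennreal_leI[OF q[OF u]] True show ?thesis
      by (simp add: emeasure_eq_measure)
  qed (simp add: F_def)
  have "emeasure M {\<omega> \<in> space M. U \<omega> \<in> E \<and> (U \<omega>, V \<omega>) \<in> G}
    = emeasure (distr M (N1 \<Otimes>\<^sub>M N2) (\<lambda>\<omega>. (U \<omega>, V \<omega>))) F"
    by (subst emeasure_distr)
      (auto simp: F_def intro!: arg_cong[where f = "emeasure M"] dest: measurable_space[OF V])
  also have "\<dots> = emeasure (distr M N1 U \<Otimes>\<^sub>M distr M N2 V) F"
    using ind unfolding indep_var_distribution_eq by simp
  also have "\<dots> = (\<integral>\<^sup>+u. emeasure (distr M N2 V) (Pair u -` F) \<partial>distr M N1 U)"
    by (rule V.emeasure_pair_measure_alt) measurable
  also have "\<dots> \<le> (\<integral>\<^sup>+u. ennreal q * indicator E u \<partial>distr M N1 U)"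
    by (intro nn_integral_mono sec) simp
  also have "\<dots> = ennreal q * emeasure M {\<omega> \<in> space M. U \<omega> \<in> E}"
    by (simp add: nn_integral_cmult_indicator emeasure_distr vimage_def Int_def conj_commute)
  finally have "ennreal (\<P>(\<omega> in M. U \<omega> \<in> E \<and> (U \<omega>, V \<omega>) \<in> G))
      \<le> ennreal q * ennreal (\<P>(\<omega> in M. U \<omega> \<in> E))"
    by (simp add: emeasure_eq_measure)
  \<comment> \<open>The bound by \<open>q\<close> is assumed only at points of \<open>N1\<close>; a
    value of \<open>U\<close> is such a point and shows that \<open>q\<close> is
    nonnegative.\<close>
  moreover obtain \<omega> where "\<omega> \<in> space M" using not_empty by auto
  then have "0 \<le> q" using measurable_space[OF U] q0 by blast
  ultimately show ?thesis by (simp add: ennreal_mult'[symmetric])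
qed

end

section \<open>Brownian motion through its increments\<close>

locale brownian = prob_space M for M :: "'a measure" +
  fixes W :: "real \<Rightarrow> 'a \<Rightarrow> real"
  assumes brownian: "standard_brownian_motion M W"
begin

lemma W_measurable [measurable]: "0 \<le> t \<Longrightarrow> W t \<in> borel_measurable M"
  using brownian by (simp add: standard_brownian_motion_def)

lemma prob_increment:
  assumes "0 \<le> s" "s < t" "A \<in> sets borel"
  shows "\<P>(\<omega> in M. (W t \<omega> - W s \<omega>) / sqrt (t - s) \<in> A) = measure gauss A"
  using brownian assms by (intro prob_normal) (auto simp: standard_brownian_motion_def)

lemma indep_increments:
  fixes \<tau> :: "nat \<Rightarrow> real"
  assumes "0 \<le> \<tau> 0" "\<And>i. i < n \<Longrightarrow> \<tau> i \<le> \<tau> (Suc i)"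
  shows "indep_vars (\<lambda>_. borel) (\<lambda>i \<omega>. W (\<tau> (Suc i)) \<omega> - W (\<tau> i) \<omega>) {..<n}"
  using brownian assms by (simp add: standard_brownian_motion_def)

lemma prob_increments2:
  assumes "0 \<le> r" "r \<le> s" "s \<le> t" and [measurable]: "A \<in> sets borel" "B \<in> sets borel"
  shows "\<P>(\<omega> in M. W s \<omega> - W r \<omega> \<in> A \<and> W t \<omega> - W s \<omega> \<in> B)
    = \<P>(\<omega> in M. W s \<omega> - W r \<omega> \<in> A) * \<P>(\<omega> in M. W t \<omega> - W s \<omega> \<in> B)"
proof -
  define \<tau> :: "nat \<Rightarrow> real" where "\<tau> i = (if i = 0 then r else if i = 1 then s else t)" for i
  define C where "C i = (if i = 0 then A else B)" for i :: nat
  have "indep_vars (\<lambda>_. borel) (\<lambda>i \<omega>. W (\<tau> (Suc i)) \<omega> - W (\<tau> i) \<omega>) {..<2}"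
    using assms by (intro indep_increments) (auto simp: \<tau>_def)
  from indep_varsD[OF this, of "{0, 1}" C]
  have "prob (\<Inter>i\<in>{0, 1}. (\<lambda>\<omega>. W (\<tau> (Suc i)) \<omega> - W (\<tau> i) \<omega>) -` C i \<inter> space M)
    = (\<Prod>i\<in>{0, 1}. prob ((\<lambda>\<omega>. W (\<tau> (Suc i)) \<omega> - W (\<tau> i) \<omega>) -` C i \<inter> space M))"
    by (auto simp: C_def)
  then show ?thesis
    by (simp add: \<tau>_def C_def vimage_def Int_def conj_commute conj_left_commute)
qed

end

section \<open>Lower bounds\<close>

context brownian
begin

lemma prob_W_interval:
  assumes "0 \<le> s" "s < t"
  shows "\<P>(\<omega> in M. a < W t \<omega> - W s \<omega> \<and> W t \<omega> - W s \<omega> < b)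
    = measure gauss {a / sqrt (t - s)<..<b / sqrt (t - s)}"
proof -
  have "(a < x \<and> x < b) \<longleftrightarrow> x / sqrt (t - s) \<in> {a / sqrt (t - s)<..<b / sqrt (t - s)}" for x
    using assms by (simp add: divide_less_cancel)
  then show ?thesis
    by (simp add: prob_increment[OF assms, symmetric] del: greaterThanLessThan_iff)
qed

lemma prob_W_interval_le:
  assumes "0 \<le> s" "s < t" "a \<le> b"
  shows "\<P>(\<omega> in M. a < W t \<omega> - W s \<omega> \<and> W t \<omega> - W s \<omega> < b) \<le> (b - a) / sqrt (2 * pi) / sqrt (t - s)"
proof -
  have "measure gauss {a / sqrt (t - s)<..<b / sqrt (t - s)}
      \<le> (b / sqrt (t - s) - a / sqrt (t - s)) / sqrt (2 * pi)"
    using assms by (intro gauss_le) (auto intro!: divide_right_mono)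
  then show ?thesis
    by (simp add: prob_W_interval[OF assms(1,2)] diff_divide_distrib mult_ac)
qed

text \<open>By scaling, \<open>J j\<close> has the same probability for every
  \<open>j \<ge> 1\<close>, which is the case of exponent 1 in
  \<open>AE_eventually_powr_le_card\<close>. On \<open>J i \<inter> J j\<close> the increment from
  \<open>i\<close> to \<open>j\<close> is smaller than \<open>c * (sqrt i + sqrt j)\<close>, an
  event independent of \<open>J i\<close>. In units of sqrt (j - i) the threshold has grown from
  \<open>c\<close> only by a multiple of sqrt (i / (j - i)), which bounds the covariance.\<close>

lemma AE_powr_le_card_parabola:
  assumes c: "0 < c"
  shows "AE \<omega> in M. \<forall>\<beta><1. \<forall>\<^sub>F m in sequentially. real m powr \<beta>
    \<le> real (card {j \<in> {1..m}. \<bar>W (real j) \<omega> - W 0 \<omega>\<bar> < c * sqrt (real j)})"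
proof -
  define J where "J j = {\<omega> \<in> space M. \<bar>W (real j) \<omega> - W 0 \<omega>\<bar> < c * sqrt (real j)}" for j
  have J [measurable]: "J j \<in> events" for j unfolding J_def by measurable
  define g where "g d = measure gauss {- d<..<d}" for d
  have prob_J: "prob (J j) = g c" if "1 \<le> j" for j
  proof -
    have "J j = {\<omega> \<in> space M. - (c * sqrt (real j)) < W (real j) \<omega> - W 0 \<omega>
        \<and> W (real j) \<omega> - W 0 \<omega> < c * sqrt (real j)}"
      by (auto simp: J_def)
    then show ?thesis
      using that prob_W_interval[of 0 "real j" "- (c * sqrt (real j))" "c * sqrt (real j)"]
      by (simp add: g_def)
  qed
  have g_pos: "0 < g c"
  proof -
    have "0 < (c - - c) / sqrt (2 * pi) * exp (- c\<^sup>2 / 2)" using c by simp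
    also have "\<dots> \<le> g c" unfolding g_def using c by (intro gauss_ge) auto
    finally show ?thesis .
  qed
  have g_le1: "g d \<le> 1" for d unfolding g_def by simp
  \<comment> \<open>Lipschitz continuity of \<open>g\<close>: two intervals of length
    \<open>d - c\<close> are added, and the Gaussian density is below 1.\<close>
  have g_diff: "g d - g c \<le> 2 * (d - c)" if "c \<le> d" for d
  proof -
    have sq: "1 \<le> sqrt (2 * pi)" using pi_ge_two by simp
    have piece: "measure gauss {x..y} \<le> y - x" if "x \<le> y" for x y
    proof -
      have "measure gauss {x..y} \<le> (y - x) / sqrt (2 * pi)" by (rule gauss_le) (use that in auto)
      also have "\<dots> \<le> (y - x) / 1" using that sq by (intro divide_left_mono) auto
      finally show ?thesis by simp
    qed
    have "g d \<le> measure gauss ({- c<..<c} \<union> ({- d..- c} \<union> {c..d}))"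
      unfolding g_def by (intro gauss.finite_measure_mono) auto
    also have "\<dots> \<le> g c + measure gauss ({- d..- c} \<union> {c..d})"
      unfolding g_def by (intro measure_Un_le) auto
    also have "measure gauss ({- d..- c} \<union> {c..d}) \<le> measure gauss {- d..- c} + measure gauss {c..d}"
      by (intro measure_Un_le) auto
    finally show ?thesis using piece[of "- d" "- c"] piece[of c d] that by simp
  qed
  have cov: "prob (J i \<inter> J j) - prob (J i) * prob (J j)
      \<le> 4 * c * (real i * real j) powr 1 / (real j * sqrt (real i * (real j - real i)))"
    if ij: "1 \<le> i" "i < j" for i j
  proof -
    define x y z where "x = sqrt (real i)" and "y = sqrt (real j)" and "z = sqrt (real j - real i)"
    have xyz: "0 < x" "0 < y" "0 < z" "x\<^sup>2 = real i" "y\<^sup>2 = real j" "z\<^sup>2 = real j - real i"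
      using ij by (auto simp: x_def y_def z_def)
    have "z \<le> y" "y \<le> x + z"
    proof -
      show "z \<le> y" by (simp add: z_def y_def)
      have "y\<^sup>2 \<le> (x + z)\<^sup>2" using xyz by (simp add: power2_sum)
      then show "y \<le> x + z" by (rule power2_le_imp_le) (use xyz in simp)
    qed
    define d where "d = c * (x + y) / z"
    have cd: "c \<le> d"
    proof -
      have "c * z \<le> c * (x + y)" using xyz(1) c \<open>z \<le> y\<close> by (intro mult_left_mono) auto
      then show ?thesis using xyz(3) by (simp add: d_def pos_le_divide_eq)
    qed
    have "prob (J i \<inter> J j)
      \<le> \<P>(\<omega> in M. W (real i) \<omega> - W 0 \<omega> \<in> {- (c * x)<..<c * x} \<and>
          W (real j) \<omega> - W (real i) \<omega> \<in> {- (c * (x + y))<..<c * (x + y)})"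
      using ij by (intro finite_measure_mono) (auto simp: J_def x_def y_def abs_less_iff algebra_simps)
    also have "\<dots> = \<P>(\<omega> in M. W (real i) \<omega> - W 0 \<omega> \<in> {- (c * x)<..<c * x}) *
        \<P>(\<omega> in M. W (real j) \<omega> - W (real i) \<omega> \<in> {- (c * (x + y))<..<c * (x + y)})"
      using ij by (intro prob_increments2) auto
    also have "\<dots> = g c * g d"
      using ij xyz(3) prob_W_interval[of 0 "real i" "- (c * x)" "c * x"]
        prob_W_interval[of "real i" "real j" "- (c * (x + y))" "c * (x + y)"]
      by (simp add: g_def x_def z_def d_def)
    finally have "prob (J i \<inter> J j) - prob (J i) * prob (J j) \<le> g c * (g d - g c)"
      using ij by (simp add: prob_J algebra_simps)
    also have "\<dots> \<le> 1 * (2 * (d - c))"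
    proof -
      have "g c * (g d - g c) \<le> g c * (2 * (d - c))"
        using g_diff[OF cd] g_pos by (intro mult_left_mono) auto
      also have "\<dots> \<le> 1 * (2 * (d - c))" using g_le1[of c] cd by (intro mult_right_mono) auto
      finally show ?thesis .
    qed
    also have "\<dots> = 2 * c * (x + y - z) / z" using xyz by (simp add: d_def field_simps)
    \<comment> \<open>The inequality \<open>y \<le> x + z\<close> bounds \<open>x + y - z\<close> by
      \<open>2 * x\<close>; a bound not vanishing with \<open>x\<close> would be too weak.\<close>
    also have "\<dots> \<le> 2 * c * (2 * x) / z"
      using xyz c \<open>y \<le> x + z\<close> by (intro divide_right_mono mult_left_mono) auto
    also have "\<dots> = 4 * c * (real i * real j) powr 1 / (real j * sqrt (real i * (real j - real i)))"
    proof -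
      have "sqrt (real i * (real j - real i)) = x * z" by (simp add: x_def z_def real_sqrt_mult)
      moreover have "(real i * real j) powr 1 = x\<^sup>2 * real j" using xyz by simp
      ultimately show ?thesis using xyz ij by (simp add: power2_eq_square)
    qed
    finally show ?thesis .
  qed
  have "AE \<omega> in M. \<forall>\<beta><1. \<forall>\<^sub>F m in sequentially. real m powr \<beta> \<le> real (card {j \<in> {1..m}. \<omega> \<in> J j})"
    by (rule AE_eventually_powr_le_card[where c = "g c" and C = "4 * c"])
       (use J g_pos c cov prob_J in auto)
  then show ?thesis
    using AE_space by eventually_elim (simp add: J_def)
qed

text \<open>An increment above 1 carries the path from \<open>(b - 1, b)\<close> past
  \<open>b\<close>, so by continuity each counted \<open>j\<close> yields a visit to
  \<open>b\<close> in \<open>[j, j + 1]\<close>. The probability is close to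
  \<open>\<kappa> / S / sqrt j\<close>, hence the exponent 1/2. For the covariance, the upper bound
  of the joint probability and the lower bound of \<open>prob (J j)\<close> must share the leading
  constant \<open>\<kappa> / S\<close>; otherwise the main terms would not cancel for small
  \<open>i / j\<close>.\<close>

lemma AE_powr_le_card_crossings:
  "AE \<omega> in M. \<forall>\<beta><1/2. \<forall>\<^sub>F m in sequentially. real m powr \<beta>
    \<le> real (card {j \<in> {1..m}. b - 1 < W (real j) \<omega> - W 0 \<omega> \<and> W (real j) \<omega> - W 0 \<omega> < b
        \<and> 1 < W (real j + 1) \<omega> - W (real j) \<omega>})"
proof -
  define X where "X t \<omega> = W t \<omega> - W 0 \<omega>" for t \<omega>
  have [measurable]: "X t \<in> borel_measurable M" if "0 \<le> t" for t
    unfolding X_def using that by measurable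
  define J where "J j = {\<omega> \<in> space M. b - 1 < X (real j) \<omega> \<and> X (real j) \<omega> < b
      \<and> 1 < W (real j + 1) \<omega> - W (real j) \<omega>}" for j
  have J [measurable]: "J j \<in> events" for j unfolding J_def by measurable
  define \<kappa> where "\<kappa> = measure gauss {1<..}"
  define S where "S = sqrt (2 * pi)"
  \<comment> \<open>Every point of \<open>(b - 1, b)\<close> has modulus at most
    \<open>\<bar>b\<bar> + 1\<close>, so the exponent of the Gaussian density of variance
    \<open>j\<close> is at least \<open>- B / j\<close> there.\<close>
  define B where "B = (\<bar>b\<bar> + 1)\<^sup>2 / 2"
  have S: "1 \<le> S" unfolding S_def using pi_ge_two by simp
  have \<kappa>_le1: "\<kappa> \<le> 1" unfolding \<kappa>_def by simp
  have \<kappa>_pos: "0 < \<kappa>"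
  proof -
    have "0 < (2 - 1) / sqrt (2 * pi) * exp (- 2\<^sup>2 / 2)" by simp
    also have "\<dots> \<le> \<kappa>" unfolding \<kappa>_def by (intro gauss_ge) auto
    finally show ?thesis .
  qed
  have prob_jump: "\<P>(\<omega> in M. 1 < W (real j + 1) \<omega> - W (real j) \<omega>) = \<kappa>" for j
    using prob_increment[of "real j" "real j + 1" "{1<..}"] by (simp add: \<kappa>_def)
  have prob_J: "prob (J j) = \<P>(\<omega> in M. b - 1 < X (real j) \<omega> \<and> X (real j) \<omega> < b) * \<kappa>" for j
    using prob_increments2[of 0 "real j" "real j + 1" "{b - 1<..<b}" "{1<..}"] prob_jump[of j]
    by (simp add: J_def X_def conj_assoc)
  have J_le: "prob (J j) \<le> \<kappa> / S / sqrt (real j)" if "1 \<le> j" for j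
    using prob_W_interval_le[of 0 "real j" "b - 1" b] that \<kappa>_pos
      mult_right_mono[of _ "1 / S / sqrt (real j)" \<kappa>]
    by (simp add: prob_J X_def S_def)
  have J_ge: "\<kappa> / S / sqrt (real j) * exp (- B / real j) \<le> prob (J j)" if "1 \<le> j" for j
  proof -
    define r where "r = (\<bar>b\<bar> + 1) / sqrt (real j)"
    have j: "0 < sqrt (real j)" using that by simp
    have "(b / sqrt (real j) - (b - 1) / sqrt (real j)) / sqrt (2 * pi) * exp (- r\<^sup>2 / 2)
        \<le> measure gauss {(b - 1) / sqrt (real j)<..<b / sqrt (real j)}"
      using j by (intro gauss_ge) (auto simp: r_def abs_divide intro!: divide_right_mono)
    moreover have "r\<^sup>2 / 2 = B / real j" by (simp add: r_def B_def power_divide)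
    moreover have "b / sqrt (real j) - (b - 1) / sqrt (real j) = 1 / sqrt (real j)"
      by (simp add: diff_divide_distrib)
    ultimately have "1 / sqrt (real j) / S * exp (- B / real j)
        \<le> \<P>(\<omega> in M. b - 1 < X (real j) \<omega> \<and> X (real j) \<omega> < b)"
      using prob_W_interval[of 0 "real j" "b - 1" b] that by (simp add: X_def S_def)
    from mult_right_mono[OF this, of \<kappa>] \<kappa>_pos show ?thesis
      by (simp add: prob_J mult_ac)
  qed
  have joint: "prob (J i \<inter> J j) \<le> \<kappa> / S / sqrt (real j - real i - 1) * prob (J i)"
    if ij: "i + 1 < j" for i j
  proof -
    \<comment> \<open>The cut is at \<open>i + 1\<close>, since \<open>J i\<close> looks that far
      ahead: increments 0 and 1 decide \<open>J i\<close> and the position at \<open>i + 1\<close>,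
      and increments 2 and 3 then decide \<open>J j\<close>. This is the origin of the unit lost in
      \<open>j - i - 1\<close>.\<close>
    define \<tau> :: "nat \<Rightarrow> real" where
      "\<tau> n = (if n = 0 then 0 else if n = 1 then real i else if n = 2 then real i + 1
        else if n = 3 then real j else real j + 1)" for n
    define \<xi> where "\<xi> n \<omega> = W (\<tau> (Suc n)) \<omega> - W (\<tau> n) \<omega>" for n \<omega>
    have ind_\<xi>: "indep_vars (\<lambda>_. borel) \<xi> {..<4}"
      unfolding \<xi>_def using ij by (intro indep_increments) (auto simp: \<tau>_def)
    define R1 R2 where "R1 \<omega> = restrict (\<lambda>n. \<xi> n \<omega>) {0, 1}" and "R2 \<omega> = restrict (\<lambda>n. \<xi> n \<omega>) {2, 3}" for \<omega>
    let ?N1 = "PiM {0, 1 :: nat} (\<lambda>_. borel :: real measure)"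
    let ?N2 = "PiM {2, 3 :: nat} (\<lambda>_. borel :: real measure)"
    have ind: "indep_var ?N1 R1 ?N2 R2"
      unfolding R1_def R2_def using ind_\<xi> by (rule indep_var_restrict) auto
    have R1_space: "R1 \<omega> \<in> space ?N1" and R2_space: "R2 \<omega> \<in> space ?N2" for \<omega>
      unfolding R1_def R2_def space_PiM by (auto simp: PiE_iff)
    define E where "E = {u \<in> space ?N1. b - 1 < u 0 \<and> u 0 < b \<and> 1 < u 1}"
    define G where "G = {p \<in> space (?N1 \<Otimes>\<^sub>M ?N2).
      b - 1 < fst p 0 + fst p 1 + snd p 2 \<and> fst p 0 + fst p 1 + snd p 2 < b \<and> 1 < snd p 3}"
    have E: "E \<in> sets ?N1" unfolding E_def by measurable
    have G: "G \<in> sets (?N1 \<Otimes>\<^sub>M ?N2)" unfolding G_def by measurable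
    have R1: "R1 \<omega> 0 = X (real i) \<omega>" "R1 \<omega> 1 = W (real i + 1) \<omega> - W (real i) \<omega>"
      and R2: "R2 \<omega> 2 = W (real j) \<omega> - W (real i + 1) \<omega>" "R2 \<omega> 3 = W (real j + 1) \<omega> - W (real j) \<omega>" for \<omega>
      by (simp_all add: R1_def R2_def \<xi>_def \<tau>_def X_def)
    have E_iff: "R1 \<omega> \<in> E \<longleftrightarrow> b - 1 < X (real i) \<omega> \<and> X (real i) \<omega> < b
        \<and> 1 < W (real i + 1) \<omega> - W (real i) \<omega>" for \<omega>
      unfolding E_def using R1_space[of \<omega>] by (simp only: mem_Collect_eq R1 simp_thms)
    have G_iff: "(R1 \<omega>, R2 \<omega>) \<in> G \<longleftrightarrow> b - 1 < X (real j) \<omega> \<and> X (real j) \<omega> < b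
        \<and> 1 < W (real j + 1) \<omega> - W (real j) \<omega>" for \<omega>
      unfolding G_def space_pair_measure mem_Collect_eq mem_Times_iff fst_conv snd_conv R1 R2
      using R1_space[of \<omega>] R2_space[of \<omega>] by (auto simp: X_def)
    have sec: "\<P>(\<omega> in M. (u, R2 \<omega>) \<in> G) \<le> \<kappa> / S / sqrt (real j - real i - 1)"
      if u: "u \<in> space ?N1" for u
    proof -
      define a where "a = b - u 0 - u 1"
      have "(u, R2 \<omega>) \<in> G \<longleftrightarrow> W (real j) \<omega> - W (real i + 1) \<omega> \<in> {a - 1<..<a}
            \<and> W (real j + 1) \<omega> - W (real j) \<omega> \<in> {1<..}" for \<omega>
        using u R2_space[of \<omega>] unfolding G_def space_pair_measure mem_Collect_eq mem_Times_iff fst_conv snd_conv R2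
        by (auto simp: a_def)
      then have "\<P>(\<omega> in M. (u, R2 \<omega>) \<in> G)
        = \<P>(\<omega> in M. W (real j) \<omega> - W (real i + 1) \<omega> \<in> {a - 1<..<a}
            \<and> W (real j + 1) \<omega> - W (real j) \<omega> \<in> {1<..})"
        by simp
      also have "\<dots> = \<P>(\<omega> in M. a - 1 < W (real j) \<omega> - W (real i + 1) \<omega>
          \<and> W (real j) \<omega> - W (real i + 1) \<omega> < a) * \<kappa>"
        using ij prob_jump[of j] by (subst prob_increments2) auto
      also have "\<dots> \<le> (a - (a - 1)) / sqrt (2 * pi) / sqrt (real j - (real i + 1)) * \<kappa>"
        using ij \<kappa>_pos by (intro mult_right_mono prob_W_interval_le) auto
      finally show ?thesis by (simp add: S_def diff_diff_eq mult_ac)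
    qed
    have "prob (J i \<inter> J j) = \<P>(\<omega> in M. R1 \<omega> \<in> E \<and> (R1 \<omega>, R2 \<omega>) \<in> G)"
      unfolding E_iff G_iff by (intro arg_cong[where f = prob]) (auto simp: J_def)
    also have "\<dots> \<le> \<kappa> / S / sqrt (real j - real i - 1) * \<P>(\<omega> in M. R1 \<omega> \<in> E)"
      by (rule prob_indep_section_le[OF ind E G sec])
    also have "\<P>(\<omega> in M. R1 \<omega> \<in> E) = prob (J i)"
      unfolding E_iff J_def ..
    finally show ?thesis .
  qed
  have cov: "prob (J i \<inter> J j) - prob (J i) * prob (J j) \<le> (2 + B) / (sqrt (real j) * sqrt (real j - real i))"
    if ij: "1 \<le> i" "i < j" for i j
  \<comment> \<open>For neighbours there is no gap between \<open>i + 1\<close> and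
    \<open>j\<close>, and \<open>joint\<close> does not apply. The trivial bound
    \<open>prob (J i)\<close> is then already of order 1 / sqrt j.\<close>
  proof (cases "j = i + 1")
    case True
    have "prob (J i \<inter> J j) - prob (J i) * prob (J j) \<le> prob (J i)"
      using finite_measure_mono[of "J i \<inter> J j" "J i"]
      by (smt (verit) J Int_lower1 mult_nonneg_nonneg measure_nonneg)
    also have "\<dots> \<le> 1 / sqrt (real i)"
    proof -
      have "\<kappa> / S / sqrt (real i) \<le> 1 / sqrt (real i)"
        using S \<kappa>_le1 by (intro divide_right_mono) (auto simp: field_simps)
      with J_le[OF ij(1)] show ?thesis by simp
    qed
    also have "\<dots> \<le> 2 / sqrt (real j)"
    proof -
      have "sqrt (real j) \<le> sqrt (4 * real i)" using True ij by (intro real_sqrt_le_mono) simp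
      then have "sqrt (real j) \<le> 2 * sqrt (real i)" by (simp add: real_sqrt_mult)
      then show ?thesis using ij by (simp add: field_simps)
    qed
    also have "\<dots> \<le> (2 + B) / (sqrt (real j) * sqrt (real j - real i))"
      using True by (simp add: B_def divide_right_mono)
    finally show ?thesis .
  next
    case False
    then have ij2: "i + 1 < j" using ij by simp
    define x y z v where "x = sqrt (real i)" and "y = sqrt (real j)"
      and "z = sqrt (real j - real i - 1)" and "v = sqrt (real j - real i)"
    have sq: "x\<^sup>2 = real i" "y\<^sup>2 = real j" "z\<^sup>2 = real j - real i - 1" "v\<^sup>2 = real j - real i"
      using ij2 by (auto simp: x_def y_def z_def v_def)
    have pos: "1 \<le> x" "0 < y" "1 \<le> z" "0 < v" "v \<le> y" "1 \<le> y"
      using ij ij2 by (auto simp: x_def y_def z_def v_def)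
    \<comment> \<open>The lost unit is absorbed at the price of two factors sqrt 2:
      \<open>1 \<le> i\<close> gives y^2 \<le> 2 x^2 + z^2, and \<open>1 \<le> z\<close> gives v^2
      \<le> 2 z^2.\<close>
    have "(y - z) / (y * z) \<le> 2 * x / (y * v)"
    proof -
      have yz: "y \<le> sqrt 2 * x + z"
      proof (rule power2_le_imp_le)
        show "y\<^sup>2 \<le> (sqrt 2 * x + z)\<^sup>2"
        proof -
          have "0 \<le> 2 * (sqrt 2 * x) * z" using pos by simp
          moreover have "(sqrt 2 * x + z)\<^sup>2 = 2 * x\<^sup>2 + z\<^sup>2 + 2 * (sqrt 2 * x) * z"
            by (simp add: power2_sum power_mult_distrib)
          moreover have "1 \<le> real i" using ij by simp
          ultimately show ?thesis unfolding sq by linarith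
        qed
      qed (use pos in auto)
      have vz: "v \<le> sqrt 2 * z"
      proof (rule power2_le_imp_le)
        show "v\<^sup>2 \<le> (sqrt 2 * z)\<^sup>2" unfolding power_mult_distrib sq using ij2 by simp
      qed (use pos(3) in simp)
      have "(y - z) * v \<le> (sqrt 2 * x) * (sqrt 2 * z)"
        using yz vz pos by (intro mult_mono) auto
      also have "\<dots> = (sqrt 2 * sqrt 2) * x * z" by (simp only: mult_ac)
      finally have "(y - z) * v \<le> 2 * x * z" by simp
      from divide_right_mono[OF this, of "y * z * v"] show ?thesis using pos by simp
    qed
    then have b1: "1 / z - 1 / y \<le> 2 * x / (y * v)" using pos by (simp add: field_simps)
    \<comment> \<open>The exponential correction is at most \<open>B / j\<close>. It fits into the
      same bound because \<open>v \<le> y \<le> j\<close> and \<open>1 \<le> x\<close>.\<close>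
    have b2: "1 / y * (1 - exp (- B / real j)) \<le> B * x / (y * v)"
    proof -
      have "1 - exp (- B / real j) \<le> B / real j" using exp_ge_add_one_self[of "- B / real j"] by simp
      also have "\<dots> \<le> B * x / v"
      proof -
        have "y * 1 \<le> y * y" using pos by (intro mult_left_mono) auto
        then have "v \<le> real j" using pos(5) by (simp flip: sq(2) add: power2_eq_square)
        then have "v * 1 \<le> real j * x" using pos by (intro mult_mono) auto
        then have "B * v \<le> B * (real j * x)" unfolding mult_1_right by (rule mult_left_mono) (simp add: B_def)
        then show ?thesis using pos(4) ij by (simp add: field_simps)
      qed
      finally have "1 - exp (- B / real j) \<le> B * x / v" .
      from mult_left_mono[OF this, of "1 / y"] show ?thesis using pos by (simp add: mult_ac)
    qed
    have "prob (J i \<inter> J j) - prob (J i) * prob (J j)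
        \<le> \<kappa> / S / z * prob (J i) - prob (J i) * (\<kappa> / S / y * exp (- B / real j))"
      using joint[OF ij2] J_ge[of j] ij mult_left_mono[OF J_ge[of j], of "prob (J i)"]
      by (simp add: z_def y_def)
    also have "\<dots> = prob (J i) * (\<kappa> / S) * ((1 / z - 1 / y) + 1 / y * (1 - exp (- B / real j)))"
      by (simp add: algebra_simps)
    also have "\<dots> \<le> prob (J i) * (\<kappa> / S) * (2 * x / (y * v) + B * x / (y * v))"
      using b1 b2 \<kappa>_pos S by (intro mult_left_mono add_mono) auto
    also have "\<dots> \<le> 1 / x * (2 * x / (y * v) + B * x / (y * v))"
    proof (rule mult_right_mono)
      have "\<kappa> / S \<le> 1" using S \<kappa>_le1 by simp
      moreover have "prob (J i) \<le> \<kappa> / S / x" using J_le[OF ij(1)] by (simp add: x_def)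
      moreover have "\<kappa> / S / x \<le> 1 / x" using \<open>\<kappa> / S \<le> 1\<close> pos by (intro divide_right_mono) auto
      ultimately show "prob (J i) * (\<kappa> / S) \<le> 1 / x"
        using \<kappa>_pos S by (smt (verit) mult_left_le measure_nonneg)
      show "0 \<le> 2 * x / (y * v) + B * x / (y * v)" using pos by (simp add: B_def)
    qed
    also have "\<dots> = (2 + B) / (y * v)" using pos by (simp add: field_simps)
    finally show ?thesis by (simp add: y_def v_def)
  qed
  have "AE \<omega> in M. \<forall>\<beta><1/2. \<forall>\<^sub>F m in sequentially. real m powr \<beta> \<le> real (card {j \<in> {1..m}. \<omega> \<in> J j})"
  proof (rule AE_eventually_powr_le_card[where c = "\<kappa> / S * exp (- B)" and C = "2 + B"])
    show "\<kappa> / S * exp (- B) * real j powr (1 / 2 - 1) \<le> prob (J j)" if j: "1 \<le> j" for j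
    proof -
      have "\<kappa> / S * exp (- B) * real j powr (1 / 2 - 1) = \<kappa> / S / sqrt (real j) * exp (- B)"
        using j by (simp add: powr_minus powr_half_sqrt field_simps)
      also have "\<dots> \<le> \<kappa> / S / sqrt (real j) * exp (- B / real j)"
      proof (rule mult_left_mono)
        have "B / real j \<le> B / 1" using j by (intro divide_left_mono) (auto simp: B_def)
        then show "exp (- B) \<le> exp (- B / real j)" by simp
      qed (use \<kappa>_pos S in simp)
      also have "\<dots> \<le> prob (J j)" by (rule J_ge[OF j])
      finally show ?thesis .
    qed
    show "prob (J i \<inter> J j) - prob (J i) * prob (J j)
        \<le> (2 + B) * (real i * real j) powr (1 / 2) / (real j * sqrt (real i * (real j - real i)))"
      if ij: "1 \<le> i" "i < j" for i j
    proof -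
      define x y where "x = sqrt (real i)" and "y = sqrt (real j)"
      have xy: "0 < x" "0 < y" "real j = y * y" using ij by (auto simp: x_def y_def)
      have "(real i * real j) powr (1 / 2) = x * y"
        by (simp add: powr_half_sqrt real_sqrt_mult x_def y_def)
      moreover have "sqrt (real i * (real j - real i)) = x * sqrt (real j - real i)"
        by (simp add: real_sqrt_mult x_def)
      ultimately have "(2 + B) * (real i * real j) powr (1 / 2) / (real j * sqrt (real i * (real j - real i)))
          = (2 + B) / (y * sqrt (real j - real i))"
        using xy by simp
      with cov[OF ij] show ?thesis by (simp add: y_def)
    qed
  qed (use J \<kappa>_pos S in \<open>auto simp: B_def\<close>)
  then show ?thesis
    using AE_space by eventually_elim (simp add: J_def X_def)
qed

end

section \<open>Upper bounds and conclusion\<close>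

text \<open>A first moment argument. The sum of \<open>j powr - \<beta>\<close> over all
  \<open>j\<close> with \<open>\<omega> \<in> J j\<close> has finite expectation because
  \<open>\<alpha> < \<beta>\<close>, so it is almost surely a finite \<open>K\<close>. Each hit up
  to \<open>m\<close> contributes at least \<open>m powr - \<beta>\<close> to it.\<close>

lemma (in prob_space) AE_card_le_powr:
  fixes J :: "nat \<Rightarrow> 'a set"
  assumes J: "\<And>j. J j \<in> events" and "\<alpha> < \<beta>" "0 \<le> \<beta>"
    and le: "\<And>j. 1 \<le> j \<Longrightarrow> prob (J j) \<le> C * real j powr (\<alpha> - 1)"
  shows "AE \<omega> in M. \<exists>K. \<forall>m. real (card {j \<in> {1..m}. \<omega> \<in> J j}) \<le> K * real m powr \<beta>"
proof -
  note [measurable] = J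
  define w where "w j = real j powr - \<beta>" for j
  define S where "S \<omega> = (\<Sum>j. ennreal (w j) * indicator (J j) \<omega>)" for \<omega>
  have [measurable]: "S \<in> borel_measurable M" unfolding S_def by measurable
  have sum: "summable (\<lambda>j. w j * prob (J j))"
  proof (rule summable_comparison_test_ev)
    show "summable (\<lambda>j. C * real j powr (\<alpha> - \<beta> - 1))"
      using \<open>\<alpha> < \<beta>\<close> by (intro summable_mult) (simp add: summable_real_powr_iff)
    show "\<forall>\<^sub>F j in sequentially. norm (w j * prob (J j)) \<le> C * real j powr (\<alpha> - \<beta> - 1)"
      using eventually_ge_at_top[of 1]
    proof eventually_elim
      case (elim j)
      have "w j * prob (J j) \<le> w j * (C * real j powr (\<alpha> - 1))"
        by (intro mult_left_mono le elim) (simp add: w_def)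
      also have "\<dots> = C * real j powr (\<alpha> - \<beta> - 1)"
        using elim by (simp add: w_def powr_add[symmetric] mult.left_commute) (simp add: algebra_simps)
      finally show ?case by (simp add: w_def)
    qed
  qed
  have "(\<integral>\<^sup>+\<omega>. S \<omega> \<partial>M) = (\<Sum>j. \<integral>\<^sup>+\<omega>. ennreal (w j) * indicator (J j) \<omega> \<partial>M)"
    unfolding S_def by (rule nn_integral_suminf) measurable
  also have "\<dots> = (\<Sum>j. ennreal (w j * prob (J j)))"
    by (intro suminf_cong)
      (simp add: nn_integral_cmult_indicator emeasure_eq_measure ennreal_mult' w_def)
  also have "\<dots> = ennreal (\<Sum>j. w j * prob (J j))"
    by (intro suminf_ennreal2 sum) (simp add: w_def)
  finally have "(\<integral>\<^sup>+\<omega>. S \<omega> \<partial>M) \<noteq> \<infinity>" by simp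
  then have "AE \<omega> in M. S \<omega> \<noteq> \<infinity>" by (intro nn_integral_PInf_AE) auto
  then show ?thesis
  proof eventually_elim
    case (elim \<omega>)
    define K where "K = enn2real (S \<omega>)"
    have "0 \<le> K" by (simp add: K_def)
    have S: "S \<omega> = ennreal K" unfolding K_def using elim by (simp add: less_top)
    have "real (card {j \<in> {1..m}. \<omega> \<in> J j}) \<le> K * real m powr \<beta>" for m
    proof (cases "m = 0")
      case False
      have "real (card {j \<in> {1..m}. \<omega> \<in> J j}) * real m powr - \<beta>
          = (\<Sum>j | j \<in> {1..m} \<and> \<omega> \<in> J j. real m powr - \<beta>)" by simp
      also have "\<dots> \<le> (\<Sum>j | j \<in> {1..m} \<and> \<omega> \<in> J j. w j)"
        unfolding w_def using \<open>0 \<le> \<beta>\<close> by (intro sum_mono powr_mono2') auto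
      also have "\<dots> = (\<Sum>j=1..m. w j * indicator (J j) \<omega>)"
        by (rule sum.mono_neutral_cong_left) auto
      finally have "ennreal (real (card {j \<in> {1..m}. \<omega> \<in> J j}) * real m powr - \<beta>)
          \<le> ennreal (\<Sum>j=1..m. w j * indicator (J j) \<omega>)" by (rule ennreal_leI)
      also have "\<dots> = (\<Sum>j=1..m. ennreal (w j) * indicator (J j) \<omega>)"
        by (subst sum_ennreal[symmetric]) (auto simp: w_def indicator_def intro!: sum.cong)
      also have "\<dots> \<le> S \<omega>"
        unfolding S_def by (rule sum_le_suminf) auto
      finally have "real (card {j \<in> {1..m}. \<omega> \<in> J j}) * real m powr - \<beta> \<le> K"
        unfolding S by (simp add: \<open>0 \<le> K\<close>)
      then show ?thesis using False by (simp add: powr_minus field_simps)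
    qed simp
    then show ?case by blast
  qed
qed

text \<open>A dyadic point of level \<open>n\<close> is reached from \<open>a\<close> with at most
  one step per level: an even numerator already belongs to the previous level, an odd one is one
  step beyond such a point. The steps form a geometric series with ratio 3/4 and sum 4; continuity
  extends the bound from dyadic points to every \<open>t\<close>.\<close>

lemma dyadic_chaining:
  fixes f :: "real \<Rightarrow> real"
  assumes cont: "continuous_on {a..a + 1} f" and "0 \<le> c"
    and step: "\<And>n k. k < 2 ^ n \<Longrightarrow>
      \<bar>f (a + real (Suc k) / 2 ^ n) - f (a + real k / 2 ^ n)\<bar> \<le> c * (3 / 4) ^ n"
    and t: "t \<in> {a..a + 1}"
  shows "\<bar>f t - f a\<bar> \<le> 4 * c"
proof -
  have dyadic: "\<bar>f (a + real k / 2 ^ n) - f a\<bar> \<le> c * (\<Sum>l\<le>n. (3 / 4) ^ l)" if "k \<le> 2 ^ n" for n k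
    using that
  proof (induction n arbitrary: k)
    case 0
    then have "k = 0 \<or> k = 1" by auto
    then show ?case using step[of 0 0] \<open>0 \<le> c\<close> by auto
  next
    case (Suc n)
    have half: "real (2 * l) / 2 ^ Suc n = real l / 2 ^ n" for l by simp
    show ?case
    proof (cases "even k")
      case True
      then obtain l where l: "k = 2 * l" by (elim evenE)
      have "\<bar>f (a + real k / 2 ^ Suc n) - f a\<bar> \<le> c * (\<Sum>l\<le>n. (3 / 4) ^ l)"
        unfolding l half using Suc.prems l by (intro Suc.IH) simp
      also have "\<dots> \<le> c * (\<Sum>l\<le>Suc n. (3 / 4) ^ l)"
        using \<open>0 \<le> c\<close> by (intro mult_left_mono) auto
      finally show ?thesis .
    next
      case False
      then obtain l where l: "k = Suc (2 * l)" by (elim oddE) simp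
      have lt: "2 * l < 2 ^ Suc n" using Suc.prems l by simp
      have "\<bar>f (a + real k / 2 ^ Suc n) - f a\<bar>
          \<le> \<bar>f (a + real (Suc (2 * l)) / 2 ^ Suc n) - f (a + real (2 * l) / 2 ^ Suc n)\<bar>
            + \<bar>f (a + real l / 2 ^ n) - f a\<bar>"
        unfolding half l by linarith
      also have "\<dots> \<le> c * (3 / 4) ^ Suc n + c * (\<Sum>l\<le>n. (3 / 4) ^ l)"
        using lt by (intro add_mono step Suc.IH) simp_all
      also have "\<dots> = c * (\<Sum>l\<le>Suc n. (3 / 4) ^ l)" by (simp add: algebra_simps)
      finally show ?thesis .
    qed
  qed
  have geom: "(\<Sum>l\<le>n. (3 / 4 :: real) ^ l) \<le> 4" for n
    by (subst sum_gp0) (simp add: field_simps)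
  have bound: "\<bar>f (a + real k / 2 ^ n) - f a\<bar> \<le> 4 * c" if "k \<le> 2 ^ n" for n k
    using dyadic[OF that] mult_left_mono[OF geom[of n] \<open>0 \<le> c\<close>] by linarith
  define k where "k n = nat \<lfloor>(t - a) * 2 ^ n\<rfloor>" for n
  define s where "s n = a + real (k n) / 2 ^ n" for n
  have k: "real (k n) = of_int \<lfloor>(t - a) * 2 ^ n\<rfloor>" for n
    using t by (simp add: k_def)
  have k_le: "real (k n) \<le> (t - a) * 2 ^ n" for n unfolding k by linarith
  have k_gt: "(t - a) * 2 ^ n - 1 < real (k n)" for n unfolding k by linarith
  have s_le: "s n \<le> t" for n using k_le[of n] by (simp add: s_def field_simps)
  have s_gt: "t - 1 / 2 ^ n \<le> s n" for n
    using divide_right_mono[OF less_imp_le[OF k_gt[of n]], of "2 ^ n"] by (simp add: s_def diff_divide_distrib)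
  have k_le2: "k n \<le> 2 ^ n" for n
  proof -
    have "real (k n) \<le> 1 * 2 ^ n"
      using t by (intro order_trans[OF k_le] mult_right_mono) auto
    then show ?thesis by simp
  qed
  have "s \<longlonglongrightarrow> t"
  proof (rule tendsto_sandwich)
    have "(\<lambda>n. t - 1 / 2 ^ n) \<longlonglongrightarrow> t - 0"
      by (intro tendsto_intros LIMSEQ_divide_realpow_zero) simp
    then show "(\<lambda>n. t - 1 / 2 ^ n) \<longlonglongrightarrow> t" by simp
    show "(\<lambda>_. t) \<longlonglongrightarrow> t" by simp
  qed (use s_le s_gt in auto)
  moreover have "s n \<in> {a..a + 1}" for n
    using s_le[of n] t k_le2[of n] by (auto simp: s_def)
  ultimately have "(\<lambda>n. f (s n)) \<longlonglongrightarrow> f t"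
    using t by (intro continuous_on_tendsto_compose[OF cont]) auto
  then have "(\<lambda>n. \<bar>f (s n) - f a\<bar>) \<longlonglongrightarrow> \<bar>f t - f a\<bar>" by (intro tendsto_intros)
  then show ?thesis
    by (rule LIMSEQ_le_const2) (use bound k_le2 in \<open>auto simp: s_def\<close>)
qed

section \<open>Oscillation on unit intervals, and the two dimensions\<close>

context brownian
begin

text \<open>The ratio \<open>3 / 4\<close> of the chaining steps exceeds \<open>1 / sqrt 2\<close>, so that a moment of high enough
  order beats the number \<open>2 ^ n\<close> of dyadic increments of level \<open>n\<close>.\<close>

lemma prob_dyadic_increment_le:
  fixes q :: nat
  assumes "0 \<le> a" "0 < c" "12 \<le> q"
  defines "K \<equiv> fact (2 * q) / (2 ^ q * fact q)"
  shows "\<P>(\<omega> in M. c * (3 / 4) ^ n < \<bar>W (a + real (Suc k) / 2 ^ n) \<omega> - W (a + real k / 2 ^ n) \<omega>\<bar>)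
    \<le> K / c ^ (2 * q) * (1 / 4) ^ n"
proof -
  let ?s = "a + real k / 2 ^ n" and ?t = "a + real (Suc k) / 2 ^ n"
  define \<sigma> where "\<sigma> = sqrt (?t - ?s)"
  have st: "0 \<le> ?s" "?s < ?t" using assms by (auto simp: divide_strict_right_mono)
  have \<sigma>: "0 < \<sigma>" "\<sigma>\<^sup>2 = 1 / 2 ^ n" using st by (auto simp: \<sigma>_def add_divide_distrib)
  \<comment> \<open>The threshold in units of the standard deviation. Its square grows like (9/8)^n,
    since (3/4)^2 * 2 = 9/8 exceeds 1.\<close>
  define d where "d = c * (3 / 4) ^ n / \<sigma>"
  have d: "0 < d" using assms \<sigma> by (simp add: d_def)
  have d2: "d\<^sup>2 = c\<^sup>2 * (9 / 8) ^ n"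
  proof -
    have "((3 / 4 :: real) ^ n)\<^sup>2 * 2 ^ n = (9 / 8) ^ n"
      by (simp add: power2_eq_square flip: power_mult_distrib)
    moreover have "d\<^sup>2 = c\<^sup>2 * (((3 / 4) ^ n)\<^sup>2 * 2 ^ n)"
      unfolding d_def power_divide \<sigma>(2) power_mult_distrib by simp
    ultimately show ?thesis by (simp only:)
  qed
  \<comment> \<open>12 is the least power of 9/8 above 4. The resulting factor (1/4)^n leaves
    (1/2)^n after summing over the 2^n increments of level \<open>n\<close>.\<close>
  have "(4::real) \<le> (9 / 8) ^ 12" by (simp add: power_divide)
  also have "\<dots> \<le> (9 / 8) ^ q" using assms by (intro power_increasing) auto
  finally have "(4::real) ^ n \<le> ((9 / 8) ^ q) ^ n" by (intro power_mono) auto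
  then have "c ^ (2 * q) * 4 ^ n \<le> c ^ (2 * q) * ((9 / 8) ^ q) ^ n"
    using assms by (intro mult_left_mono) auto
  also have "\<dots> = d ^ (2 * q)"
    unfolding power_mult d2 by (simp add: power_mult_distrib power_mult[symmetric] mult.commute)
  finally have pow: "c ^ (2 * q) * 4 ^ n \<le> d ^ (2 * q)" .
  have "\<P>(\<omega> in M. c * (3 / 4) ^ n < \<bar>W ?t \<omega> - W ?s \<omega>\<bar>)
    = \<P>(\<omega> in M. (W ?t \<omega> - W ?s \<omega>) / \<sigma> \<in> {x. d < \<bar>x\<bar>})"
  proof -
    have "c * (3 / 4) ^ n < \<bar>x\<bar> \<longleftrightarrow> x / \<sigma> \<in> {x. d < \<bar>x\<bar>}" for x
      using \<sigma>(1) by (simp add: d_def abs_divide divide_less_cancel)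
    then show ?thesis by (simp only:)
  qed
  also have "\<dots> = measure gauss {x. d < \<bar>x\<bar>}"
    unfolding \<sigma>_def by (rule prob_increment[OF st]) measurable
  also have "\<dots> \<le> K / d ^ (2 * q)" unfolding K_def by (rule gauss_tail_le[OF d])
  also have "\<dots> \<le> K / (c ^ (2 * q) * 4 ^ n)"
    using pow assms d by (intro divide_left_mono) (auto simp: K_def)
  finally show ?thesis by (simp add: power_divide)
qed

text \<open>Chaining with \<open>c = j powr \<epsilon>\<close>: a union bound over all levels and
  increments bounds the failure probability in \<open>[j, j + 1]\<close> by a multiple of 1 / j^2,
  which is summable for Borel-Cantelli.\<close>

lemma AE_oscillation_le:
  assumes "0 < \<epsilon>"
  shows "AE \<omega> in M. \<forall>\<^sub>F j in sequentially. \<forall>t\<in>{real j..real j + 1}.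
    \<bar>W t \<omega> - W (real j) \<omega>\<bar> \<le> 4 * real j powr \<epsilon>"
proof -
  obtain q0 :: nat where q0: "1 / \<epsilon> \<le> real q0" using real_arch_simple by blast
  \<comment> \<open>The bound 12 serves the sum over dyadic levels;
    \<open>1 \<le> \<epsilon> * q\<close> turns the factor
    \<open>j powr (- 2 * \<epsilon> * q)\<close> into at most 1 / j^2.\<close>
  define q where "q = max 12 q0"
  have q: "12 \<le> q" "1 \<le> \<epsilon> * real q"
    using q0 assms by (auto simp: q_def field_simps max_def intro: order_trans)
  define K :: real where "K = fact (2 * q) / (2 ^ q * fact q)"
  have K: "0 \<le> K" by (simp add: K_def)
  define V where "V j n k = {\<omega> \<in> space M. real j powr \<epsilon> * (3 / 4) ^ n
    < \<bar>W (real j + real (Suc k) / 2 ^ n) \<omega> - W (real j + real k / 2 ^ n) \<omega>\<bar>}" for j n k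
  have V [measurable]: "V j n k \<in> events" for j n k unfolding V_def by measurable
  define U where "U j n = (\<Union>k<2 ^ n. V j n k)" for j n
  have U [measurable]: "U j n \<in> events" for j n unfolding U_def by measurable
  have prob_V: "prob (V j n k) \<le> K * inverse (real j ^ 2) * (1 / 4) ^ n" if "1 \<le> j" for j n k
  proof -
    have "prob (V j n k) \<le> K / (real j powr \<epsilon>) ^ (2 * q) * (1 / 4) ^ n"
      unfolding V_def K_def using that q by (intro prob_dyadic_increment_le) auto
    also have "(real j powr \<epsilon>) ^ (2 * q) = real j powr (2 * (\<epsilon> * real q))"
      using that by (simp add: powr_realpow[symmetric] powr_powr mult_ac)
    also have "K / real j powr (2 * (\<epsilon> * real q)) * (1 / 4) ^ n \<le> K / real j powr 2 * (1 / 4) ^ n"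
      using that q K by (intro mult_right_mono divide_left_mono powr_mono mult_pos_pos) auto
    also have "real j powr 2 = real j ^ 2" using that by simp
    finally show ?thesis by (simp only: divide_inverse)
  qed
  have prob_U: "prob (U j n) \<le> K * inverse (real j ^ 2) * (1 / 2) ^ n" if "1 \<le> j" for j n
  proof -
    have "prob (U j n) \<le> (\<Sum>k<2 ^ n. prob (V j n k))"
      unfolding U_def by (intro finite_measure_subadditive_finite) auto
    also have "\<dots> \<le> (\<Sum>k<(2 ^ n :: nat). K * inverse (real j ^ 2) * (1 / 4) ^ n)"
      by (intro sum_mono prob_V that)
    also have "\<dots> = K * inverse (real j ^ 2) * (2 ^ n * (1 / 4) ^ n)" by simp
    also have "2 ^ n * (1 / 4 :: real) ^ n = (1 / 2) ^ n" by (simp flip: power_mult_distrib)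
    finally show ?thesis .
  qed
  have geom: "(\<lambda>n. (1 / 2 :: real) ^ n) sums 2" using geometric_sums[of "1 / 2 :: real"] by simp
  have prob_UU: "prob (\<Union>n. U j n) \<le> K * inverse (real j ^ 2) * 2" if "1 \<le> j" for j
  proof -
    have sums: "(\<lambda>n. K * inverse (real j ^ 2) * (1 / 2) ^ n) sums (K * inverse (real j ^ 2) * 2)"
      by (intro sums_mult geom)
    have summ: "summable (\<lambda>n. prob (U j n))"
      by (rule summable_comparison_test[OF _ sums_summable[OF sums]])
        (use prob_U[OF that] in auto)
    have "prob (\<Union>n. U j n) \<le> (\<Sum>n. prob (U j n))"
      by (intro finite_measure_subadditive_countably summ) auto
    also have "\<dots> \<le> (\<Sum>n. K * inverse (real j ^ 2) * (1 / 2) ^ n)"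
      by (intro suminf_le prob_U that summ sums_summable[OF sums])
    also have "\<dots> = K * inverse (real j ^ 2) * 2" using sums by (rule sums_unique[symmetric])
    finally show ?thesis .
  qed
  have "summable (\<lambda>j. prob (\<Union>n. U j n))"
  proof (rule summable_comparison_test_ev)
    show "summable (\<lambda>j. K * inverse (real j ^ 2) * 2)"
      using inverse_power_summable[of 2, where 'a = real] by (intro summable_mult summable_mult2) simp
    show "\<forall>\<^sub>F j in sequentially. norm (prob (\<Union>n. U j n)) \<le> K * inverse (real j ^ 2) * 2"
      using eventually_ge_at_top[of 1] by eventually_elim (use prob_UU in simp)
  qed
  then have "AE \<omega> in M. \<forall>\<^sub>F j in sequentially. \<omega> \<in> space M - (\<Union>n. U j n)"
    by (intro borel_cantelli_AE1) (auto simp: emeasure_eq_measure)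
  moreover have "AE \<omega> in M. continuous_on {0..} (\<lambda>t. W t \<omega>)"
    using brownian by (simp add: standard_brownian_motion_def)
  ultimately show ?thesis
  proof eventually_elim
    case (elim \<omega>)
    from elim(1) show ?case
    proof eventually_elim
      case (elim j)
      have "\<bar>W t \<omega> - W (real j) \<omega>\<bar> \<le> 4 * real j powr \<epsilon>" if "t \<in> {real j..real j + 1}" for t
      proof (rule dyadic_chaining[OF _ _ _ that])
        show "continuous_on {real j..real j + 1} (\<lambda>t. W t \<omega>)"
          using \<open>continuous_on {0..} _\<close> by (rule continuous_on_subset) auto
        show "\<bar>W (real j + real (Suc k) / 2 ^ n) \<omega> - W (real j + real k / 2 ^ n) \<omega>\<bar>
            \<le> real j powr \<epsilon> * (3 / 4) ^ n" if "k < 2 ^ n" for n k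
          using elim that by (auto simp: U_def V_def not_less)
      qed simp
      then show ?case by blast
    qed
  qed
qed

lemma AE_unit_cells_level_le:
  assumes "0 < \<epsilon>"
  shows "AE \<omega> in M. \<forall>\<^sub>F m in sequentially.
    real (unit_cells m {t. 0 < t \<and> \<bar>W t \<omega> - W 0 \<omega>\<bar> = b}) \<le> real m powr (1 / 2 + \<epsilon>)"
proof -
  \<comment> \<open>Three losses share \<open>\<epsilon>\<close>: the strip of width
    \<open>j powr \<delta>\<close> around the level, the passage from expected to almost sure
    counts, and the absorption of the random constants \<open>K\<close> and
    \<open>N\<close>.\<close>
  define \<delta> where "\<delta> = \<epsilon> / 3"
  have \<delta>: "0 < \<delta>" "\<epsilon> = 3 * \<delta>" using assms by (auto simp: \<delta>_def)
  define X where "X t \<omega> = W t \<omega> - W 0 \<omega>" for t \<omega>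
  have [measurable]: "X t \<in> borel_measurable M" if "0 \<le> t" for t
    unfolding X_def using that by measurable
  \<comment> \<open>The factor 5 exceeds the oscillation factor 4, which makes the inequality
    strict.\<close>
  define J where "J j = {\<omega> \<in> space M. \<bar>\<bar>X (real j) \<omega>\<bar> - b\<bar> < 5 * real j powr \<delta>}" for j
  have J [measurable]: "J j \<in> events" for j unfolding J_def by measurable
  have prob_J: "prob (J j) \<le> 20 * real j powr (1 / 2 + \<delta> - 1)" if j: "1 \<le> j" for j
  proof -
    define r where "r = 5 * real j powr \<delta>"
    have "1 \<le> sqrt (2 * pi)" using pi_ge_two by simp
    have near: "\<P>(\<omega> in M. a - r < X (real j) \<omega> \<and> X (real j) \<omega> < a + r) \<le> 2 * r / sqrt (real j)" for a
    proof -
      have "\<P>(\<omega> in M. a - r < X (real j) \<omega> \<and> X (real j) \<omega> < a + r)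
          \<le> (2 * r) / sqrt (2 * pi) / sqrt (real j)"
        using prob_W_interval_le[of 0 "real j" "a - r" "a + r"] j by (simp add: X_def r_def)
      also have "\<dots> \<le> (2 * r) / 1 / sqrt (real j)"
        using \<open>1 \<le> sqrt (2 * pi)\<close> j
        by (intro divide_right_mono divide_left_mono) (auto simp: r_def)
      finally show ?thesis by simp
    qed
    have "prob (J j) \<le> prob ({\<omega> \<in> space M. b - r < X (real j) \<omega> \<and> X (real j) \<omega> < b + r}
        \<union> {\<omega> \<in> space M. - b - r < X (real j) \<omega> \<and> X (real j) \<omega> < - b + r})"
      by (intro finite_measure_mono) (auto simp: J_def r_def abs_if split: if_splits)
    also have "\<dots> \<le> 2 * r / sqrt (real j) + 2 * r / sqrt (real j)"
      by (intro order_trans[OF measure_Un_le] add_mono near) measurable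
    also have "\<dots> = 20 * (real j powr \<delta> / real j powr (1 / 2))"
      using j by (simp add: r_def powr_half_sqrt)
    also have "real j powr \<delta> / real j powr (1 / 2) = real j powr (1 / 2 + \<delta> - 1)"
      by (simp add: powr_diff[symmetric])
    finally show ?thesis .
  qed
  have "AE \<omega> in M. \<exists>K. \<forall>m. real (card {j \<in> {1..m}. \<omega> \<in> J j}) \<le> K * real m powr (1 / 2 + 2 * \<delta>)"
    by (rule AE_card_le_powr[OF J _ _ prob_J]) (use \<delta> in auto)
  with AE_oscillation_le[OF \<delta>(1)] AE_space show ?thesis
  proof eventually_elim
    case (elim \<omega>)
    then obtain K where K: "\<And>m. real (card {j \<in> {1..m}. \<omega> \<in> J j}) \<le> K * real m powr (1 / 2 + 2 * \<delta>)"
      by blast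
    from elim(1) obtain N where N: "\<forall>j\<ge>N. \<forall>t\<in>{real j..real j + 1}.
        \<bar>W t \<omega> - W (real j) \<omega>\<bar> \<le> 4 * real j powr \<delta>"
      unfolding eventually_sequentially by blast
    let ?A = "{t. 0 < t \<and> \<bar>W t \<omega> - W 0 \<omega>\<bar> = b}"
    \<comment> \<open>The oscillation is controlled only from \<open>N\<close> on; the earlier cells
      are all counted, at a cost of \<open>N + 1\<close>.\<close>
    have cells: "unit_cells m ?A \<le> N + 1 + card {j \<in> {1..m}. \<omega> \<in> J j}" for m
    proof -
      have "j \<in> {0..N} \<union> {j \<in> {1..m}. \<omega> \<in> J j}"
        if "j \<in> {0..m}" "{real j..real j + 1} \<inter> ?A \<noteq> {}" for j
      proof (cases "j \<le> N")
        case False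
        from that(2) obtain t where "t \<in> {real j..real j + 1} \<inter> ?A" by blast
        then have t: "t \<in> {real j..real j + 1}" "\<bar>X t \<omega>\<bar> = b" by (simp_all add: X_def)
        have "\<bar>X t \<omega> - X (real j) \<omega>\<bar> \<le> 4 * real j powr \<delta>"
          using N t(1) False by (auto simp: X_def)
        moreover have "0 < real j powr \<delta>" using False by simp
        ultimately have "\<bar>\<bar>X (real j) \<omega>\<bar> - b\<bar> < 5 * real j powr \<delta>" using t(2) by linarith
        with elim(2) False that show ?thesis by (auto simp: J_def)
      qed simp
      then have "{j \<in> {0..m}. {real j..real j + 1} \<inter> ?A \<noteq> {}} \<subseteq> {0..N} \<union> {j \<in> {1..m}. \<omega> \<in> J j}"
        by blast
      then have "unit_cells m ?A \<le> card ({0..N} \<union> {j \<in> {1..m}. \<omega> \<in> J j})"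
        unfolding unit_cells_def by (intro card_mono) auto
      also have "\<dots> \<le> card {0..N} + card {j \<in> {1..m}. \<omega> \<in> J j}" by (rule card_Un_le)
      finally show ?thesis by simp
    qed
    have "\<forall>\<^sub>F m in sequentially. real N + 1 + K * real m powr (1 / 2 + 2 * \<delta>) \<le> real m powr (1 / 2 + 3 * \<delta>)"
      using \<delta>(1) by real_asymp
    then show ?case
    proof eventually_elim
      case (elim m)
      have "real (unit_cells m ?A) \<le> real (N + 1 + card {j \<in> {1..m}. \<omega> \<in> J j})"
        using cells by (simp only: of_nat_le_iff)
      also have "\<dots> \<le> real N + 1 + K * real m powr (1 / 2 + 2 * \<delta>)" using K[of m] by simp
      finally show ?case using elim \<delta>(2) by simp
    qed
  qed
qed

text \<open>The sets increase with \<open>c\<close>, so the thresholds \<open>1 / (n + 1)\<close>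
  give one null set for all \<open>c\<close>. The upper bound is deterministic, as there are only
  \<open>m + 1\<close> cells.\<close>

lemma AE_has_minkowski_dim_parabola:
  "AE \<omega> in M. \<forall>c>0. has_minkowski_dim {t. 0 < t \<and> \<bar>W t \<omega> - W 0 \<omega>\<bar> < c * sqrt t} 1"
proof -
  have "AE \<omega> in M. \<forall>n. \<forall>\<beta><1. \<forall>\<^sub>F m in sequentially. real m powr \<beta>
    \<le> real (card {j \<in> {1..m}. \<bar>W (real j) \<omega> - W 0 \<omega>\<bar> < 1 / real (Suc n) * sqrt (real j)})"
    unfolding AE_all_countable by (intro allI AE_powr_le_card_parabola) simp
  then show ?thesis
  proof eventually_elim
    case (elim \<omega>)
    show ?case
    proof (intro allI impI)
      fix c :: real assume "0 < c"
      then obtain n where n: "1 / real (Suc n) < c" by (metis nat_approx_posE)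
      let ?A = "{t. 0 < t \<and> \<bar>W t \<omega> - W 0 \<omega>\<bar> < c * sqrt t}"
      have cells: "card {j \<in> {1..m}. \<bar>W (real j) \<omega> - W 0 \<omega>\<bar> < 1 / real (Suc n) * sqrt (real j)}
          \<le> unit_cells m ?A" for m
      proof -
        have "{real j..real j + 1} \<inter> ?A \<noteq> {}"
          if "1 \<le> j" "\<bar>W (real j) \<omega> - W 0 \<omega>\<bar> < 1 / real (Suc n) * sqrt (real j)" for j
        proof -
          have "1 / real (Suc n) * sqrt (real j) \<le> c * sqrt (real j)"
            using n by (intro mult_right_mono) auto
          with that have "real j \<in> {real j..real j + 1} \<inter> ?A" by auto
          then show ?thesis by blast
        qed
        then show ?thesis unfolding unit_cells_def by (intro card_mono) auto
      qed
      show "has_minkowski_dim ?A 1"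
      proof (rule has_minkowski_dimI)
        fix \<beta> :: real assume "\<beta> < 1"
        with elim have "\<forall>\<^sub>F m in sequentially. real m powr \<beta>
          \<le> real (card {j \<in> {1..m}. \<bar>W (real j) \<omega> - W 0 \<omega>\<bar> < 1 / real (Suc n) * sqrt (real j)})"
          by blast
        then show "\<forall>\<^sub>F m in sequentially. real m powr \<beta> \<le> real (unit_cells m ?A)"
          by eventually_elim (use cells in \<open>meson of_nat_mono order_trans\<close>)
      qed (rule eventually_unit_cells_le_powr)
    qed
  qed
qed

lemma AE_has_minkowski_dim_level:
  assumes "0 \<le> b"
  shows "AE \<omega> in M. has_minkowski_dim {t. 0 < t \<and> \<bar>W t \<omega> - W 0 \<omega>\<bar> = b} (1 / 2)"
proof -
  have "AE \<omega> in M. \<forall>n. \<forall>\<^sub>F m in sequentially.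
      real (unit_cells m {t. 0 < t \<and> \<bar>W t \<omega> - W 0 \<omega>\<bar> = b}) \<le> real m powr (1 / 2 + 1 / real (Suc n))"
    unfolding AE_all_countable by (intro allI AE_unit_cells_level_le) simp
  moreover have "AE \<omega> in M. continuous_on {0..} (\<lambda>t. W t \<omega>)"
    using brownian by (simp add: standard_brownian_motion_def)
  ultimately show ?thesis using AE_powr_le_card_crossings[of b]
  proof eventually_elim
    case (elim \<omega>)
    let ?A = "{t. 0 < t \<and> \<bar>W t \<omega> - W 0 \<omega>\<bar> = b}"
    define C where "C m = {j \<in> {1..m}. b - 1 < W (real j) \<omega> - W 0 \<omega> \<and> W (real j) \<omega> - W 0 \<omega> < b
        \<and> 1 < W (real j + 1) \<omega> - W (real j) \<omega>}" for m :: nat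
    have "{real j..real j + 1} \<inter> ?A \<noteq> {}" if "j \<in> C m" for j m
    proof -
      have "continuous_on {real j..real j + 1} (\<lambda>t. W t \<omega> - W 0 \<omega>)"
        by (intro continuous_intros continuous_on_subset[OF elim(2)]) auto
      moreover have "W (real j) \<omega> - W 0 \<omega> \<le> b" "b \<le> W (real j + 1) \<omega> - W 0 \<omega>"
        using that by (auto simp: C_def)
      ultimately obtain t where "real j \<le> t" "t \<le> real j + 1" "W t \<omega> - W 0 \<omega> = b"
        using IVT'[of "\<lambda>t. W t \<omega> - W 0 \<omega>" "real j" b "real j + 1"] by auto
      \<comment> \<open>Here \<open>j \<ge> 1\<close> ensures \<open>0 < t\<close>, and
        \<open>0 \<le> b\<close> removes the absolute value.\<close>
      then have "t \<in> {real j..real j + 1} \<inter> ?A" using that assms by (auto simp: C_def)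
      then show ?thesis by blast
    qed
    then have cells: "card (C m) \<le> unit_cells m ?A" for m
      unfolding unit_cells_def by (intro card_mono) (auto simp: C_def)
    show ?case
    proof (rule has_minkowski_dimI)
      fix \<beta> :: real assume "\<beta> < 1 / 2"
      with elim(3) have "\<forall>\<^sub>F m in sequentially. real m powr \<beta> \<le> real (card (C m))"
        unfolding C_def by blast
      then show "\<forall>\<^sub>F m in sequentially. real m powr \<beta> \<le> real (unit_cells m ?A)"
        by eventually_elim (use cells in \<open>meson of_nat_mono order_trans\<close>)
    next
      fix \<beta> :: real assume "1 / 2 < \<beta>"
      then obtain n where n: "1 / real (Suc n) < \<beta> - 1 / 2" by (metis nat_approx_posE diff_gt_0_iff_gt)
      from elim(1) have "\<forall>\<^sub>F m in sequentially. real (unit_cells m ?A) \<le> real m powr (1 / 2 + 1 / real (Suc n))"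
        by blast
      then show "\<forall>\<^sub>F m in sequentially. real (unit_cells m ?A) \<le> real m powr \<beta>"
        using eventually_ge_at_top[of 1]
      proof eventually_elim
        case (elim m)
        have "real m powr (1 / 2 + 1 / real (Suc n)) \<le> real m powr \<beta>"
          using n elim(2) by (intro powr_mono) auto
        with elim(1) show ?case by simp
      qed
    qed
  qed
qed

end

section \<open>The explicit value at the origin, at all times simultaneously\<close>

lemma continuous_on_eq_if_eq_Rats:
  fixes f g :: "real \<Rightarrow> real"
  assumes "continuous_on {0<..} f" "continuous_on {0<..} g"
    and eq: "\<And>q. q \<in> \<rat> \<Longrightarrow> 0 < q \<Longrightarrow> f q = g q" and "0 < t"
  shows "f t = g t"
proof (rule ccontr)
  assume "f t \<noteq> g t"
  define U where "U = {0<..} \<inter> (\<lambda>x. f x - g x) -` (- {0})"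
  have "open U"
    unfolding U_def by (intro continuous_open_preimage continuous_intros assms open_Compl)
  moreover have "t \<in> U" using \<open>0 < t\<close> \<open>f t \<noteq> g t\<close> by (simp add: U_def)
  ultimately obtain e where e: "0 < e" "ball t e \<subseteq> U" by (auto simp: open_contains_ball)
  obtain q where "q \<in> \<rat>" "t < q" "q < t + e" using Rats_dense_in_real[of t "t + e"] e by auto
  then have "q \<in> ball t e" by (simp add: dist_real_def)
  with e have "q \<in> U" by blast
  with eq[OF \<open>q \<in> \<rat>\<close>] show False by (auto simp: U_def)
qed

lemma heat_kernel_product:
  assumes "0 < \<nu>" "0 < t"
  shows "heat_kernel \<nu> t 0 * heat_kernel \<nu> t x = exp (- (x\<^sup>2 / (4 * \<nu> * t))) / (4 * pi * \<nu> * t)"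
proof -
  have "(4 * pi * \<nu> * t) powr (- 1 / 2) * (4 * pi * \<nu> * t) powr (- 1 / 2) = 1 / (4 * pi * \<nu> * t)"
    using assms by (simp add: powr_add[symmetric] powr_minus_divide)
  then show ?thesis by (simp add: heat_kernel_def flip: mult.assoc)
qed

text \<open>The closed form is given for each fixed time with its own null set. Countably many of
  these cover the rational times; the field and the Brownian path are continuous, which yields the
  remaining times.\<close>

lemma AE_Gamma_origin:
  assumes BM: "standard_brownian_motion M W" and "0 < \<rho> 0" "0 < \<nu>" and \<Gamma>: "is_Gamma M W \<nu> \<rho> \<Gamma>"
  shows "AE \<omega> in M. \<forall>t>0. \<Gamma> t 0 0 \<omega>
    = exp (- (\<rho> 0 * (W t \<omega> - W 0 \<omega>)\<^sup>2 / (4 * \<nu> * t))) / (4 * pi * \<nu> * t)"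
proof -
  have "AE \<omega> in M. \<forall>q\<in>\<rat> \<inter> {0<..}. \<Gamma> q 0 0 \<omega> = heat_kernel \<nu> q 0 * heat_kernel \<nu> q (sqrt (\<rho> 0) * W q \<omega>)"
    using \<Gamma> by (intro AE_ball_countable' countable_Int1 countable_rat) (auto simp: is_Gamma_def)
  moreover have "AE \<omega> in M. regular_field (\<lambda>t x y. \<Gamma> t x y \<omega>)"
    using \<Gamma> by (simp add: is_Gamma_def stratonovich_solution_def)
  moreover have "AE \<omega> in M. continuous_on {0..} (\<lambda>t. W t \<omega>)" "AE \<omega> in M. W 0 \<omega> = 0"
    using BM by (simp_all add: standard_brownian_motion_def)
  ultimately show ?thesis
  proof eventually_elim
    case (elim \<omega>)
    have "continuous_on ({0<..} \<times> UNIV \<times> UNIV) (\<lambda>(t, x, y). \<Gamma> t x y \<omega>)"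
      using elim(2) by (simp add: regular_field_def continuous_field_def)
    moreover have "continuous_on {0<..} (\<lambda>t :: real. (t, 0 :: real, 0 :: real))"
      by (intro continuous_on_Pair continuous_on_id continuous_on_const)
    moreover have "(\<lambda>t :: real. (t, 0 :: real, 0 :: real)) ` {0<..} \<subseteq> {0<..} \<times> UNIV \<times> UNIV" by auto
    ultimately have cont_\<Gamma>: "continuous_on {0<..} (\<lambda>t. \<Gamma> t 0 0 \<omega>)"
      using continuous_on_compose2 by fastforce
    have "continuous_on {0<..} (\<lambda>t. W t \<omega>)"
      using elim(3) by (rule continuous_on_subset) auto
    then have cont: "continuous_on {0<..} (\<lambda>t. exp (- (\<rho> 0 * (W t \<omega> - W 0 \<omega>)\<^sup>2 / (4 * \<nu> * t))) / (4 * pi * \<nu> * t))"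
      using \<open>0 < \<nu>\<close> by (intro continuous_intros) auto
    show ?case
    proof (intro allI impI)
      fix t :: real assume "0 < t"
      show "\<Gamma> t 0 0 \<omega> = exp (- (\<rho> 0 * (W t \<omega> - W 0 \<omega>)\<^sup>2 / (4 * \<nu> * t))) / (4 * pi * \<nu> * t)"
      proof (rule continuous_on_eq_if_eq_Rats[OF cont_\<Gamma> cont _ \<open>0 < t\<close>])
        fix q :: real assume "q \<in> \<rat>" "0 < q"
        with elim(1,4) assms(2,3) show "\<Gamma> q 0 0 \<omega>
            = exp (- (\<rho> 0 * (W q \<omega> - W 0 \<omega>)\<^sup>2 / (4 * \<nu> * q))) / (4 * pi * \<nu> * q)"
          by (simp add: heat_kernel_product power_mult_distrib)
      qed
    qed
  qed
qed

theorem theorem9p1: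
  fixes M :: "'a measure" and W :: "real \<Rightarrow> 'a \<Rightarrow> real"
    and \<rho> :: "real \<Rightarrow> real" and \<nu> :: real
    and \<Gamma> :: "real \<Rightarrow> real \<Rightarrow> real \<Rightarrow> 'a \<Rightarrow> real"
  assumes W: "standard_brownian_motion M W"
    and \<rho>_const: "\<forall>x. \<rho> x = \<rho> 0"
    and \<rho>_pos: "\<rho> 0 > 0"
    and \<nu>_pos: "\<nu> > 0"
    and \<Gamma>: "is_Gamma M W \<nu> \<rho> \<Gamma>"
  shows "(AE \<omega> in M. \<forall>K>0.
            has_minkowski_dim {t. t > 0 \<and> \<Gamma> t 0 0 \<omega> > K / t}
              (if K < 1 / (4 * pi * \<nu>) then 1 else 0)) \<and>
         (\<forall>x :: real. AE \<omega> in M.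
            has_minkowski_dim
              {t. t > 0 \<and> \<Gamma> t 0 0 \<omega> = exp (- x\<^sup>2 / (4 * \<nu> * t)) / (4 * pi * \<nu> * t)}
              (1 / 2))"
proof -
  interpret brownian M W
    using W by (simp add: brownian_def brownian_axioms_def standard_brownian_motion_def)
  define X where "X t \<omega> = W t \<omega> - W 0 \<omega>" for t \<omega>
  have \<Gamma>_eq: "AE \<omega> in M. \<forall>t>0. \<Gamma> t 0 0 \<omega> = exp (- (\<rho> 0 * (X t \<omega>)\<^sup>2 / (4 * \<nu> * t))) / (4 * pi * \<nu> * t)"
    unfolding X_def by (rule AE_Gamma_origin[OF W \<rho>_pos \<nu>_pos \<Gamma>])
  show ?thesis
  proof (intro conjI allI)
    have "AE \<omega> in M. \<forall>c>0. has_minkowski_dim {t. 0 < t \<and> \<bar>X t \<omega>\<bar> < c * sqrt t} 1"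
      unfolding X_def by (rule AE_has_minkowski_dim_parabola)
    with \<Gamma>_eq show "AE \<omega> in M. \<forall>K>0. has_minkowski_dim {t. t > 0 \<and> \<Gamma> t 0 0 \<omega> > K / t}
        (if K < 1 / (4 * pi * \<nu>) then 1 else 0)"
    proof eventually_elim
      case (elim \<omega>)
      show ?case
      proof (intro allI impI)
        fix K :: real assume "0 < K"
        \<comment> \<open>Taking logarithms turns the tall-peak condition into X^2 < (4 \<nu> L /
          \<rho>) t. The sign of \<open>L\<close> separates the two cases: it is positive exactly
          when \<open>K\<close> is below the critical value.\<close>
        define L where "L = - ln (4 * pi * \<nu> * K)"
        have exp_L: "exp (- L) = 4 * pi * \<nu> * K" using \<open>0 < K\<close> \<nu>_pos by (simp add: L_def)
        have iff: "K / t < \<Gamma> t 0 0 \<omega> \<longleftrightarrow> (X t \<omega>)\<^sup>2 < 4 * \<nu> * L / \<rho> 0 * t" if "0 < t" for t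
        proof -
          have "K / t < \<Gamma> t 0 0 \<omega> \<longleftrightarrow> exp (- L) < exp (- (\<rho> 0 * (X t \<omega>)\<^sup>2 / (4 * \<nu> * t)))"
          proof -
            define e where "e = exp (- (\<rho> 0 * (X t \<omega>)\<^sup>2 / (4 * \<nu> * t)))"
            have \<Gamma>_e: "\<Gamma> t 0 0 \<omega> = e / (4 * pi * \<nu> * t)" using elim(1) that by (simp add: e_def)
            show ?thesis
              unfolding exp_L e_def[symmetric] \<Gamma>_e using that \<nu>_pos by (simp add: field_simps)
          qed
          also have "\<dots> \<longleftrightarrow> (X t \<omega>)\<^sup>2 < 4 * \<nu> * L / \<rho> 0 * t"
            using that \<nu>_pos \<rho>_pos by (simp add: field_simps)
          finally show ?thesis .
        qed
        show "has_minkowski_dim {t. t > 0 \<and> \<Gamma> t 0 0 \<omega> > K / t} (if K < 1 / (4 * pi * \<nu>) then 1 else 0)"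
        proof (cases "K < 1 / (4 * pi * \<nu>)")
          case True
          then have "4 * pi * \<nu> * K < 1" using \<nu>_pos by (simp add: field_simps)
          then have L: "0 < L" using \<open>0 < K\<close> \<nu>_pos by (simp add: L_def)
          define c where "c = sqrt (4 * \<nu> * L / \<rho> 0)"
          have c: "0 < c" using L \<nu>_pos \<rho>_pos by (simp add: c_def)
          have "(X t \<omega>)\<^sup>2 < 4 * \<nu> * L / \<rho> 0 * t \<longleftrightarrow> \<bar>X t \<omega>\<bar> < c * sqrt t" for t
          proof -
            have "\<bar>X t \<omega>\<bar> < sqrt (4 * \<nu> * L / \<rho> 0 * t) \<longleftrightarrow> sqrt ((X t \<omega>)\<^sup>2) < sqrt (4 * \<nu> * L / \<rho> 0 * t)"
              by simp
            then show ?thesis unfolding c_def real_sqrt_mult[symmetric] real_sqrt_less_iff by blast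
          qed
          then have "{t. t > 0 \<and> \<Gamma> t 0 0 \<omega> > K / t} = {t. 0 < t \<and> \<bar>X t \<omega>\<bar> < c * sqrt t}"
            using iff by auto
          with elim(2) c True show ?thesis by simp
        next
          case False
          then have "1 \<le> 4 * pi * \<nu> * K" using \<nu>_pos by (simp add: field_simps)
          then have L: "L \<le> 0" by (simp add: L_def)
          have "\<not> (X t \<omega>)\<^sup>2 < 4 * \<nu> * L / \<rho> 0 * t" if "0 < t" for t
          proof -
            have "4 * \<nu> * L \<le> 0" using L \<nu>_pos by (intro mult_nonneg_nonpos) auto
            then have "4 * \<nu> * L / \<rho> 0 \<le> 0" using \<rho>_pos by (rule divide_nonpos_pos)
            then have "4 * \<nu> * L / \<rho> 0 * t \<le> 0" using that by (intro mult_nonpos_nonneg) auto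
            then show ?thesis by (smt (verit) zero_le_power2)
          qed
          then have "{t. t > 0 \<and> \<Gamma> t 0 0 \<omega> > K / t} = {}" using iff by auto
          with False show ?thesis
            by (simp add: has_minkowski_dim_def upper_minkowski_dim_def lower_minkowski_dim_def)
        qed
      qed
    qed
  next
    fix x :: real
    \<comment> \<open>Equality of the exponents means \<rho> X^2 = x^2, that is,
      \<open>\<bar>X t \<omega>\<bar> = b\<close>.\<close>
    define b where "b = \<bar>x\<bar> / sqrt (\<rho> 0)"
    have "0 \<le> b" using \<rho>_pos by (simp add: b_def)
    have "AE \<omega> in M. has_minkowski_dim {t. 0 < t \<and> \<bar>X t \<omega>\<bar> = b} (1 / 2)"
      unfolding X_def by (rule AE_has_minkowski_dim_level) fact
    with \<Gamma>_eq show "AE \<omega> in M. has_minkowski_dim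
        {t. t > 0 \<and> \<Gamma> t 0 0 \<omega> = exp (- x\<^sup>2 / (4 * \<nu> * t)) / (4 * pi * \<nu> * t)} (1 / 2)"
    proof eventually_elim
      case (elim \<omega>)
      have "\<Gamma> t 0 0 \<omega> = exp (- x\<^sup>2 / (4 * \<nu> * t)) / (4 * pi * \<nu> * t) \<longleftrightarrow> \<bar>X t \<omega>\<bar> = b" if "0 < t" for t
      proof -
        have "\<Gamma> t 0 0 \<omega> = exp (- x\<^sup>2 / (4 * \<nu> * t)) / (4 * pi * \<nu> * t)
            \<longleftrightarrow> \<rho> 0 * (X t \<omega>)\<^sup>2 = x\<^sup>2"
          using elim(1) that \<nu>_pos by simp
        also have "\<rho> 0 * (X t \<omega>)\<^sup>2 = (sqrt (\<rho> 0) * X t \<omega>)\<^sup>2"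
          using \<rho>_pos by (simp add: power_mult_distrib)
        also have "\<dots> = x\<^sup>2 \<longleftrightarrow> \<bar>sqrt (\<rho> 0) * X t \<omega>\<bar> = \<bar>x\<bar>"
          by (metis power2_abs abs_ge_zero power2_eq_iff_nonneg)
        also have "\<dots> \<longleftrightarrow> \<bar>X t \<omega>\<bar> = b"
          using \<rho>_pos by (simp add: b_def abs_mult field_simps)
        finally show ?thesis .
      qed
      then have "{t. t > 0 \<and> \<Gamma> t 0 0 \<omega> = exp (- x\<^sup>2 / (4 * \<nu> * t)) / (4 * pi * \<nu> * t)}
          = {t. 0 < t \<and> \<bar>X t \<omega>\<bar> = b}" by auto
      with elim(2) show ?case by simp
    qed
  qed
qed

end
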